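(* Let $A$ be a $C^*$-algebra, $X$ a Hilbert $A$-module, $\mathcal{H},\mathcal{K}$ Hilbert spaces, $\varphi:A\to L(\mathcal{H})$ a contractive completely positive linear map and $\Phi:X\to L(\mathcal{H},\mathcal{K})$ a $\varphi$-map. If $\widetilde{\varphi}_\Phi:\mathcal{L}(X)\to L(\mathcal{K}\oplus\mathcal{H})$ is the completely positive linear map on the linking algebra $\mathcal{L}(X)$ associated to the $\varphi$-map $\Phi$, then $\mathcal{L}_{M_\varphi}(X_\varphi)\subseteq M_{\widetilde{\varphi}_\Phi}$. Moreover, $$M_{\widetilde{\varphi}_\Phi}=\left\{\begin{bmatrix}T&y\\ x^*&a\end{bmatrix}:T\in K(X),\ x,y\in X_\varphi,\ a\in M_\varphi\right\},$$ and also $$T_{\widetilde{\varphi}_\Phi}=\left\{\begin{bmatrix}T&y\\ x^*&a\end{bmatrix}:T\in K(X),\ x,y\in X_\varphi,\ a\in T_\varphi\right\}.$$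
   Context: Hilbert $C^*$-modules are right modules, with inner product linear in the second variable. $L(\mathcal{H},\mathcal{K})$ denotes bounded linear operators, $L(\mathcal{H})=L(\mathcal{H},\mathcal{H})$, and $[\,\cdot\,]$ closed linear span. A map $\Phi:X\to L(\mathcal{H},\mathcal{K})$ is a $\varphi$-map if $\Phi(x)^*\Phi(y)=\varphi(\langle x,y\rangle)$ for all $x,y\in X$; if $\varphi$ is a $*$-homomorphism it is called a $\varphi$-representation. For a completely positive map $\psi:B\to L(\mathcal{E})$ on a $C^*$-algebra $B$: $M_\psi=\{a\in B:\psi(ab)=\psi(a)\psi(b),\ \psi(ba)=\psi(b)\psi(a)\ \forall b\in B\}$ (multiplicative domain) and $T_\psi=\{a\in M_\psi:\psi(ba^*c)=\psi(b)\psi(a)^*\psi(c)\ \forall b,c\in B\}$ (ternary domain). The ternary domain $X_\varphi$ of $\varphi$ on $X$ is the set $\{x\in X:\Phi(xb)=\Phi(x)\varphi(b)\text{ for all }b\in A\}$, where $\Phi$ is any operator-valued $\varphi$-map on $X$ (the set is the same for every choice of $\Phi$; equivalently $X_\varphi=\{x\in X:\langle x,x\rangle\in T_\varphi\}$). It is a Hilbert $C^*$-module over $M_\varphi$. $K(X)$ is the $C^*$-algebra of compact operators on $X$, the closed linear span of the operators $\theta_{x,y}(z)=x\langle y,z\rangle$. The linking $C^*$-algebra is $\mathcal{L}(X)=\left\{\begin{bmatrix}T&x\\ y^*&a\end{bmatrix}:T\in K(X),\ x,y\in X,\ a\in A\right\}$, identified with the compact operators on $X\oplus A$ (here $x$ is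 the operator $a\mapsto xa$, $y^*$ is $z\mapsto\langle y,z\rangle$, and $a$ is left multiplication). $\mathcal{L}_{M_\varphi}(X_\varphi)=\left\{\begin{bmatrix}T&y\\ x^*&a\end{bmatrix}:T\in K(X_\varphi),\ x,y\in X_\varphi,\ a\in M_\varphi\right\}$ is the linking algebra of the Hilbert $M_\varphi$-module $X_\varphi$, viewed inside $\mathcal{L}(X)$, with $K(X_\varphi)$ identified with the closed linear span of $\{\theta_{x,y}:x,y\in X_\varphi\}$ in $K(X)$. A minimal Stinespring representation associated to $(\varphi,\Phi)$ consists of Hilbert spaces $\mathcal{H}',\mathcal{K}'$, a $*$-representation $\pi:A\to L(\mathcal{H}')$, a $\pi$-representation $\Pi:X\to L(\mathcal{H}',\mathcal{K}')$, a bounded operator $V:\mathcal{H}\to\mathcal{H}'$ and a coisometry $W:\mathcal{K}\to\mathcal{K}'$ with $\varphi(\cdot)=V^*\pi(\cdot)V$, $[\pi(A)V\mathcal{H}]=\mathcal{H}'$, $\Phi(\cdot)=W^*\Pi(\cdot)V$, $[\Pi(X)V\mathcal{H}]=\mathcal{K}'$; such a representation exists. $\phi_{\Phi,\varphi}:K(X)\to L(\mathcal{K})$ is the $*$-representation determined by $\phi_{\Phi,\varphi}(\theta_{x,y})=W^*\Pi(x)\Pi(y)^*W$ (independent of the choice of minimal Stinespring representation), and $\widetilde{\varphi}_\Phi$ is the completely positive map $\begin{bmatrix}T&x\\ y^*&a\end{bmatrix}\mapsto\begin{bmatrix}\phi_{\Phi,\varphi}(T)&\Phi(x)\\ \Phi(y)^*&\varphi(a)\end{bmatrix}$.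 *)

theory Defs
  imports "HOL-Analysis.Analysis"
begin

section \<open>Complex normed spaces, Hilbert spaces and C*-algebras\<close>

class scaleC =
  fixes scaleC :: "complex \<Rightarrow> 'a \<Rightarrow> 'a"  (infixr "*\<^sub>C" 75)

class complex_normed_vector = real_normed_vector + scaleC +
  assumes scaleC_add_right: "c *\<^sub>C (x + y) = c *\<^sub>C x + c *\<^sub>C y"
    and scaleC_add_left: "(c + d) *\<^sub>C x = c *\<^sub>C x + d *\<^sub>C x"
    and scaleC_scaleC: "c *\<^sub>C (d *\<^sub>C x) = (c * d) *\<^sub>C x"
    and scaleC_of_real: "complex_of_real r *\<^sub>C x = r *\<^sub>R x"
    and norm_scaleC: "norm (c *\<^sub>C x) = cmod c * norm x"

text \<open>The inner product is linear in the second variable.\<close>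

class chilbert_space = complex_normed_vector + complete_space +
  fixes cinner :: "'a \<Rightarrow> 'a \<Rightarrow> complex"
  assumes cinner_add_right: "cinner x (y + z) = cinner x y + cinner x z"
    and cinner_scaleC_right: "cinner x (c *\<^sub>C y) = c * cinner x y"
    and cinner_commute: "cinner y x = cnj (cinner x y)"
    and cinner_self: "cinner x x = complex_of_real ((norm x)\<^sup>2)"

text \<open>C*-algebras are not assumed to be unital, and may be zero.\<close>

class cstar_algebra = complex_normed_vector + real_normed_algebra + complete_space +
  fixes star :: "'a \<Rightarrow> 'a"
  assumes mult_scaleC_left: "(c *\<^sub>C a) * b = c *\<^sub>C (a * b)"
    and mult_scaleC_right: "a * (c *\<^sub>C b) = c *\<^sub>C (a * b)"
    and star_add: "star (a + b) = star a + star b"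
    and star_scaleC: "star (c *\<^sub>C a) = cnj c *\<^sub>C star a"
    and star_mult: "star (a * b) = star b * star a"
    and star_star: "star (star a) = a"
    and cstar_identity: "norm (star a * a) = (norm a)\<^sup>2"

definition closed_cspan :: "'a::complex_normed_vector set \<Rightarrow> 'a set" where
  "closed_cspan S = closure (module.span scaleC S)"

instantiation prod :: (complex_normed_vector, complex_normed_vector) complex_normed_vector
begin
definition "c *\<^sub>C p = (c *\<^sub>C fst p, c *\<^sub>C snd p)"
instance
proof
  fix c d :: complex and r :: real and x y :: "'a \<times> 'b"
  show "c *\<^sub>C (x + y) = c *\<^sub>C x + c *\<^sub>C y" "(c + d) *\<^sub>C x = c *\<^sub>C x + d *\<^sub>C x"
    "c *\<^sub>C (d *\<^sub>C x) = (c * d) *\<^sub>C x" "complex_of_real r *\<^sub>C x = r *\<^sub>R x"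
    by (simp_all add: scaleC_prod_def scaleC_add_right scaleC_add_left scaleC_scaleC
        scaleC_of_real prod_eq_iff)
  have "norm (c *\<^sub>C x) = sqrt ((cmod c)\<^sup>2 * ((norm (fst x))\<^sup>2 + (norm (snd x))\<^sup>2))"
    by (simp add: scaleC_prod_def norm_prod_def norm_scaleC power_mult_distrib distrib_left)
  then show "norm (c *\<^sub>C x) = cmod c * norm x"
    by (simp add: real_sqrt_mult norm_prod_def)
qed
end

instantiation prod :: (chilbert_space, chilbert_space) chilbert_space
begin
definition "cinner p q = cinner (fst p) (fst q) + cinner (snd p) (snd q)"
instance
proof
  fix c :: complex and x y z :: "'a \<times> 'b"
  show "cinner x (y + z) = cinner x y + cinner x z" "cinner x (c *\<^sub>C y) = c * cinner x y"
    by (simp_all add: cinner_prod_def scaleC_prod_def cinner_add_right cinner_scaleC_right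
        algebra_simps)
  show "cinner y x = cnj (cinner x y)"
    unfolding cinner_prod_def by (metis cinner_commute complex_cnj_add)
  show "cinner x x = complex_of_real ((norm x)\<^sup>2)"
    by (simp add: cinner_prod_def cinner_self norm_prod_def)
qed
end

lemma bounded_linear_scaleC:
  fixes F :: "'a::real_normed_vector \<Rightarrow>\<^sub>L 'b::complex_normed_vector"
  shows "bounded_linear (\<lambda>x. c *\<^sub>C F x)"
proof (rule bounded_linear_intro[where K = "cmod c * norm F"])
  fix x y :: 'a and r :: real
  show "c *\<^sub>C F (x + y) = c *\<^sub>C F x + c *\<^sub>C F y"
    by (simp add: blinfun.add_right scaleC_add_right)
  show "c *\<^sub>C F (r *\<^sub>R x) = r *\<^sub>R (c *\<^sub>C F x)"
    by (simp add: blinfun.scaleR_right scaleC_of_real[symmetric] scaleC_scaleC mult.commute)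
  show "norm (c *\<^sub>C F x) \<le> norm x * (cmod c * norm F)"
    using mult_left_mono[OF norm_blinfun[of F x] norm_ge_zero[of c]]
    by (simp add: norm_scaleC algebra_simps)
qed

instantiation blinfun :: (real_normed_vector, complex_normed_vector) complex_normed_vector
begin
definition "c *\<^sub>C F = Blinfun (\<lambda>x. c *\<^sub>C blinfun_apply F x)"

lemma scaleC_blinfun_apply: "blinfun_apply (c *\<^sub>C F) x = c *\<^sub>C blinfun_apply F x"
  by (simp add: scaleC_blinfun_def bounded_linear_Blinfun_apply[OF bounded_linear_scaleC])

instance
proof
  fix c d :: complex and r :: real and x y :: "'a \<Rightarrow>\<^sub>L 'b"
  show "c *\<^sub>C (x + y) = c *\<^sub>C x + c *\<^sub>C y" "(c + d) *\<^sub>C x = c *\<^sub>C x + d *\<^sub>C x"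
    "c *\<^sub>C (d *\<^sub>C x) = (c * d) *\<^sub>C x" "complex_of_real r *\<^sub>C x = r *\<^sub>R x"
    by (auto intro!: blinfun_eqI simp: scaleC_blinfun_apply plus_blinfun.rep_eq
        scaleR_blinfun.rep_eq scaleC_add_right scaleC_add_left scaleC_scaleC scaleC_of_real)
  have le: "norm (e *\<^sub>C z) \<le> cmod e * norm z" for e and z :: "'a \<Rightarrow>\<^sub>L 'b"
  proof (rule norm_blinfun_bound)
    show "norm ((e *\<^sub>C z) u) \<le> cmod e * norm z * norm u" for u
      using mult_left_mono[OF norm_blinfun[of z u] norm_ge_zero[of e]]
      by (simp add: scaleC_blinfun_apply norm_scaleC mult.assoc)
  qed simp
  show "norm (c *\<^sub>C x) = cmod c * norm x"
  proof (cases "c = 0")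
    case True
    then show ?thesis using le[of c x] by simp
  next
    case False
    have "inverse c *\<^sub>C (c *\<^sub>C x) = x"
      using False scaleC_of_real[of 1]
      by (auto intro!: blinfun_eqI simp: scaleC_blinfun_apply scaleC_scaleC)
    then have "norm x \<le> inverse (cmod c) * norm (c *\<^sub>C x)"
      using le[of "inverse c" "c *\<^sub>C x"] by (simp add: norm_inverse)
    then have "cmod c * norm x \<le> norm (c *\<^sub>C x)"
      using False by (simp add: field_simps)
    then show ?thesis using le[of c x] by simp
  qed
qed
end

section \<open>Bounded operators\<close>

text \<open>The space \<open>L(H, K)\<close>, as a subset of the library's type of bounded real-linear maps, whose
  norm is the operator norm.\<close>

definition bdd_ops :: "('h::complex_normed_vector \<Rightarrow>\<^sub>L 'k::complex_normed_vector) set" where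
  "bdd_ops = {F. \<forall>c x. blinfun_apply F (c *\<^sub>C x) = c *\<^sub>C blinfun_apply F x}"

text \<open>The adjoint with respect to given inner products; it serves both Hilbert spaces
  (complex-valued inner product) and Hilbert modules (algebra-valued inner product).\<close>

definition adjoint_wrt ::
  "('x \<Rightarrow> 'x \<Rightarrow> 'a) \<Rightarrow> ('y \<Rightarrow> 'y \<Rightarrow> 'a) \<Rightarrow>
   ('x::real_normed_vector \<Rightarrow>\<^sub>L 'y::real_normed_vector) \<Rightarrow> ('y \<Rightarrow>\<^sub>L 'x)" where
  "adjoint_wrt ip1 ip2 F = (THE G. \<forall>u v. ip2 (blinfun_apply F u) v = ip1 u (blinfun_apply G v))"

abbreviation adj :: "('h::chilbert_space \<Rightarrow>\<^sub>L 'k::chilbert_space) \<Rightarrow> ('k \<Rightarrow>\<^sub>L 'h)"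
  where "adj \<equiv> adjoint_wrt cinner cinner"

definition block_op ::
  "('k \<Rightarrow>\<^sub>L 'k) \<Rightarrow> ('h \<Rightarrow>\<^sub>L 'k) \<Rightarrow> ('k \<Rightarrow>\<^sub>L 'h) \<Rightarrow> ('h \<Rightarrow>\<^sub>L 'h) \<Rightarrow>
   ('k::real_normed_vector \<times> 'h::real_normed_vector) \<Rightarrow>\<^sub>L ('k \<times> 'h)" where
  "block_op P Q R S = Blinfun (\<lambda>(k, h). (P k + Q h, R k + S h))"

lemma block_op_apply: "block_op P Q R S (k, h) = (P k + Q h, R k + S h)"
proof -
  have "bounded_linear (\<lambda>p. (P (fst p) + Q (snd p), R (fst p) + S (snd p)))"
    by (intro bounded_linear_Pair bounded_linear_add
        bounded_linear_compose[OF blinfun.bounded_linear_right]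
        bounded_linear_fst bounded_linear_snd)
  then show ?thesis
    by (simp add: block_op_def case_prod_beta' bounded_linear_Blinfun_apply)
qed

section \<open>Completely positive maps and their multiplicative and ternary domains\<close>

text \<open>Positive elements of the C*-algebra of \<open>n \<times> n\<close> matrices are those of the form \<open>b\<^sup>* b\<close>.\<close>

definition pos_matrix :: "nat \<Rightarrow> (nat \<Rightarrow> nat \<Rightarrow> 'a::cstar_algebra) \<Rightarrow> bool" where
  "pos_matrix n a \<longleftrightarrow> (\<exists>b. \<forall>i<n. \<forall>j<n. a i j = (\<Sum>k<n. star (b k i) * b k j))"

definition completely_positive ::
  "('a::cstar_algebra \<Rightarrow> ('h::chilbert_space \<Rightarrow>\<^sub>L 'h)) \<Rightarrow> bool" where
  "completely_positive \<phi> \<longleftrightarrow>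
     (\<forall>a. \<phi> a \<in> bdd_ops) \<and>
     (\<forall>a b. \<phi> (a + b) = \<phi> a + \<phi> b) \<and>
     (\<forall>c a. \<phi> (c *\<^sub>C a) = c *\<^sub>C \<phi> a) \<and>
     (\<forall>n a. pos_matrix n a \<longrightarrow>
        (\<forall>h. (\<Sum>i<n. \<Sum>j<n. cinner (h i) (\<phi> (a i j) (h j))) \<in> \<real>\<^sub>\<ge>\<^sub>0))"

text \<open>The C*-algebras below are either whole types or subsets of spaces of operators, so the
  algebra enters through its carrier \<open>B\<close>, its product \<open>m\<close> and its involution \<open>s\<close>.\<close>

definition mult_domain ::
  "'b set \<Rightarrow> ('b \<Rightarrow> 'b \<Rightarrow> 'b) \<Rightarrow> ('b \<Rightarrow> ('e::chilbert_space \<Rightarrow>\<^sub>L 'e)) \<Rightarrow> 'b set" where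
  "mult_domain B m \<psi> =
     {a \<in> B. \<forall>b\<in>B. \<psi> (m a b) = \<psi> a o\<^sub>L \<psi> b \<and> \<psi> (m b a) = \<psi> b o\<^sub>L \<psi> a}"

definition ternary_domain ::
  "'b set \<Rightarrow> ('b \<Rightarrow> 'b \<Rightarrow> 'b) \<Rightarrow> ('b \<Rightarrow> 'b) \<Rightarrow>
   ('b \<Rightarrow> ('e::chilbert_space \<Rightarrow>\<^sub>L 'e)) \<Rightarrow> 'b set" where
  "ternary_domain B m s \<psi> =
     {a \<in> mult_domain B m \<psi>. \<forall>b\<in>B. \<forall>c\<in>B.
        \<psi> (m (m b (s a)) c) = \<psi> b o\<^sub>L adj (\<psi> a) o\<^sub>L \<psi> c}"

definition star_representation ::
  "'b::complex_normed_vector set \<Rightarrow> ('b \<Rightarrow> 'b \<Rightarrow> 'b) \<Rightarrow> ('b \<Rightarrow> 'b) \<Rightarrow>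
   ('b \<Rightarrow> ('e::chilbert_space \<Rightarrow>\<^sub>L 'e)) \<Rightarrow> bool" where
  "star_representation B m s \<rho> \<longleftrightarrow>
     (\<forall>a\<in>B. \<rho> a \<in> bdd_ops) \<and>
     (\<forall>a\<in>B. \<forall>b\<in>B. \<rho> (a + b) = \<rho> a + \<rho> b) \<and>
     (\<forall>c. \<forall>a\<in>B. \<rho> (c *\<^sub>C a) = c *\<^sub>C \<rho> a) \<and>
     (\<forall>a\<in>B. \<forall>b\<in>B. \<rho> (m a b) = \<rho> a o\<^sub>L \<rho> b) \<and>
     (\<forall>a\<in>B. \<rho> (s a) = adj (\<rho> a))"

section \<open>Hilbert C*-modules\<close>

locale hilbert_module =
  fixes act :: "'x::{complex_normed_vector, complete_space} \<Rightarrow> 'a::cstar_algebra \<Rightarrow> 'x"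
    and ip :: "'x \<Rightarrow> 'x \<Rightarrow> 'a"
  assumes act_add_left: "act (x + y) a = act x a + act y a"
    and act_add_right: "act x (a + b) = act x a + act x b"
    and act_act: "act (act x a) b = act x (a * b)"
    and act_scaleC_left: "act (c *\<^sub>C x) a = c *\<^sub>C act x a"
    and act_scaleC_right: "act x (c *\<^sub>C a) = c *\<^sub>C act x a"
    and ip_add_right: "ip x (y + z) = ip x y + ip x z"
    and ip_scaleC_right: "ip x (c *\<^sub>C y) = c *\<^sub>C ip x y"
    and ip_act_right: "ip x (act y a) = ip x y * a"
    and ip_star: "star (ip x y) = ip y x"
    and ip_pos: "\<exists>b. ip x x = star b * b"
    and norm_eq_ip: "norm x = sqrt (norm (ip x x))"

definition theta ::
  "('x::complex_normed_vector \<Rightarrow> 'a \<Rightarrow> 'x) \<Rightarrow> ('x \<Rightarrow> 'x \<Rightarrow> 'a) \<Rightarrow> 'x \<Rightarrow> 'x \<Rightarrow> ('x \<Rightarrow>\<^sub>L 'x)" where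
  "theta act ip x y = Blinfun (\<lambda>z. act x (ip y z))"

text \<open>For \<open>Y = UNIV\<close> this is \<open>K(X)\<close>; for a submodule \<open>Y\<close> it is \<open>K(Y)\<close> inside \<open>K(X)\<close>.\<close>

definition compact_ops ::
  "('x::complex_normed_vector \<Rightarrow> 'a \<Rightarrow> 'x) \<Rightarrow> ('x \<Rightarrow> 'x \<Rightarrow> 'a) \<Rightarrow> 'x set \<Rightarrow> ('x \<Rightarrow>\<^sub>L 'x) set" where
  "compact_ops act ip Y = closed_cspan {theta act ip x y | x y. x \<in> Y \<and> y \<in> Y}"

text \<open>The matrix with rows \<open>T, x\<close> and \<open>y\<^sup>*, a\<close>, as an operator on \<open>X \<oplus> A\<close>. The norm of the product
  type is equivalent to the Hilbert module norm of \<open>X \<oplus> A\<close>.\<close>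

definition link_op ::
  "('x::complex_normed_vector \<Rightarrow> 'a::cstar_algebra \<Rightarrow> 'x) \<Rightarrow> ('x \<Rightarrow> 'x \<Rightarrow> 'a) \<Rightarrow>
   ('x \<Rightarrow>\<^sub>L 'x) \<Rightarrow> 'x \<Rightarrow> 'x \<Rightarrow> 'a \<Rightarrow> (('x \<times> 'a) \<Rightarrow>\<^sub>L ('x \<times> 'a))" where
  "link_op act ip T x y a = Blinfun (\<lambda>(z, b). (T z + act x b, ip y z + a * b))"

definition sum_ip ::
  "('x \<Rightarrow> 'x \<Rightarrow> 'a::cstar_algebra) \<Rightarrow> 'x \<times> 'a \<Rightarrow> 'x \<times> 'a \<Rightarrow> 'a" where
  "sum_ip ip u v = ip (fst u) (fst v) + star (snd u) * snd v"

text \<open>With \<open>\<K> = K(X)\<close>, \<open>Y = UNIV\<close>, \<open>D = UNIV\<close> this is the linking algebra of \<open>X\<close>; its product is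
  composition and its involution is \<open>adjoint_wrt (sum_ip ip) (sum_ip ip)\<close>.\<close>

definition link_set ::
  "('x::complex_normed_vector \<Rightarrow> 'a::cstar_algebra \<Rightarrow> 'x) \<Rightarrow> ('x \<Rightarrow> 'x \<Rightarrow> 'a) \<Rightarrow>
   ('x \<Rightarrow>\<^sub>L 'x) set \<Rightarrow> 'x set \<Rightarrow> 'a set \<Rightarrow> (('x \<times> 'a) \<Rightarrow>\<^sub>L ('x \<times> 'a)) set" where
  "link_set act ip \<K> Y D = {link_op act ip T x y a | T x y a. T \<in> \<K> \<and> x \<in> Y \<and> y \<in> Y \<and> a \<in> D}"

abbreviation linking_algebra where
  "linking_algebra act ip \<equiv> link_set act ip (compact_ops act ip UNIV) UNIV UNIV"

context hilbert_module
begin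

lemma ip_add_left: "ip (x + y) z = ip x z + ip y z"
  by (metis ip_add_right ip_star star_add)

lemma ip_scaleC_left: "ip (c *\<^sub>C x) y = cnj c *\<^sub>C ip x y"
  by (metis ip_scaleC_right ip_star star_scaleC)

lemma ip_zero: "ip x 0 = 0" "ip 0 x = 0"
  using ip_add_right[of x 0 0] ip_add_left[of 0 0 x] by simp_all

lemma norm_ip_self: "norm (ip x x) = (norm x)\<^sup>2"
  by (simp add: norm_eq_ip)

lemma norm_star_eq: "norm (star a) = norm (a::'a)"
proof -
  have le: "norm a \<le> norm (star a)" for a :: 'a
  proof (cases "a = 0")
    case False
    have "norm a * norm a \<le> norm (star a) * norm a"
      using norm_mult_ineq[of "star a" a] by (simp add: cstar_identity power2_eq_square)
    then show ?thesis using False by simp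
  qed simp
  show ?thesis using le[of a] le[of "star a"] by (simp add: star_star)
qed

text \<open>By polarization; the factor \<open>4\<close> can be dropped, but boundedness is all that is needed
  for \<open>theta\<close> and \<open>link_op\<close> to be the intended operators.\<close>

lemma norm_ip_le: "norm (ip x y) \<le> 4 * norm x * norm y"
proof -
  have polar: "4 *\<^sub>C ip u v = ip (u + v) (u + v) + (-1) *\<^sub>C ip (u + (-1) *\<^sub>C v) (u + (-1) *\<^sub>C v)
      + (- \<i>) *\<^sub>C ip (u + \<i> *\<^sub>C v) (u + \<i> *\<^sub>C v) + \<i> *\<^sub>C ip (u + (- \<i>) *\<^sub>C v) (u + (- \<i>) *\<^sub>C v)"
    for u v
  proof -
    have cancel: "c *\<^sub>C w + (- c) *\<^sub>C w = 0" for c and w :: 'a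
      using scaleC_add_left[of c "- c" w] scaleC_of_real[of 0 w] by simp
    have one: "1 *\<^sub>C w = w" for w :: 'a
      using scaleC_of_real[of 1 w] by simp
    have four: "4 *\<^sub>C w = w + w + w + w" for w :: 'a
    proof -
      have "4 *\<^sub>C w = (1 + 1 + 1 + 1) *\<^sub>R w"
        using scaleC_of_real[of 4 w] by simp
      then show ?thesis by (simp only: scaleR_add_left scaleR_one)
    qed
    have neg: "(-1) *\<^sub>C w = - w" for w :: 'a
      using scaleC_of_real[of "-1" w] by simp
    have negi: "(- \<i>) *\<^sub>C w = - (\<i> *\<^sub>C w)" for w :: 'a
      using cancel[of "\<i>" w] by (simp add: eq_neg_iff_add_eq_0 add.commute)
    have i2: "\<i> *\<^sub>C (\<i> *\<^sub>C w) = - w" for w :: 'a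
      using neg by (simp add: scaleC_scaleC)
    have minus: "\<i> *\<^sub>C (- w) = - (\<i> *\<^sub>C w)" for w :: 'a
      using scaleC_scaleC[of "\<i>" "-1" w] by (simp only: neg mult_minus1_right negi)
    have diff: "\<i> *\<^sub>C (w - w') = \<i> *\<^sub>C w - \<i> *\<^sub>C w'" for w w' :: 'a
      using scaleC_add_right[of "\<i>" w "- w'"] by (simp add: minus)
    show ?thesis
      unfolding ip_add_left ip_add_right ip_scaleC_left ip_scaleC_right
      by (simp add: four neg negi i2 minus diff scaleC_add_right)
  qed
  have unit: "norm (ip u v) \<le> 4" if "norm u = 1" "norm v = 1" for u v
  proof -
    have b: "norm (ip (u + c *\<^sub>C v) (u + c *\<^sub>C v)) \<le> 4" if "cmod c = 1" for c
    proof -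
      have "norm (u + c *\<^sub>C v) \<le> 2"
        using norm_triangle_ineq[of u "c *\<^sub>C v"] that \<open>norm u = 1\<close> \<open>norm v = 1\<close>
        by (simp add: norm_scaleC)
      then have "(norm (u + c *\<^sub>C v))\<^sup>2 \<le> 2\<^sup>2" by (rule power_mono) simp
      then show ?thesis by (simp add: norm_ip_self)
    qed
    have "norm (4 *\<^sub>C ip u v) \<le> 4 + 4 + 4 + 4"
      unfolding polar
      using b[of 1] scaleC_of_real[of 1 v] b[of "-1"] b[of "\<i>"] b[of "- \<i>"]
      by (intro norm_triangle_mono) (simp_all add: norm_scaleC)
    then show ?thesis by (simp add: norm_scaleC)
  qed
  show ?thesis
  proof (cases "x = 0 \<or> y = 0")
    case True
    then show ?thesis by (auto simp: ip_zero)
  next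
    case False
    define u where "u = complex_of_real (inverse (norm x)) *\<^sub>C x"
    define v where "v = complex_of_real (inverse (norm y)) *\<^sub>C y"
    have "norm (ip u v) \<le> 4"
      using False by (intro unit) (simp_all add: u_def v_def norm_scaleC norm_inverse)
    moreover have "norm (ip u v) = inverse (norm x) * inverse (norm y) * norm (ip x y)"
      by (simp add: u_def v_def ip_scaleC_left ip_scaleC_right norm_scaleC norm_inverse)
    ultimately show ?thesis using False by (simp add: field_simps)
  qed
qed

lemma bounded_linear_ip: "bounded_linear (ip y)"
proof (rule bounded_linear_intro[where K = "4 * norm y"])
  show "ip y (r *\<^sub>R x) = r *\<^sub>R ip y x" for r x
    by (simp add: ip_scaleC_right flip: scaleC_of_real)
  show "norm (ip y x) \<le> norm x * (4 * norm y)" for x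
    using norm_ip_le[of y x] by (simp add: algebra_simps)
qed (rule ip_add_right)

lemma norm_act_le: "norm (act x a) \<le> norm x * norm a"
proof -
  have "ip (act x a) (act x a) = star a * ip x x * a"
    by (metis ip_act_right ip_star star_mult mult.assoc)
  then have "(norm (act x a))\<^sup>2 = norm (star a * ip x x * a)"
    by (simp flip: norm_ip_self)
  also have "\<dots> \<le> norm (star a) * norm (ip x x) * norm a"
    by (meson norm_mult_ineq mult_right_mono norm_ge_zero order_trans)
  also have "\<dots> = (norm x * norm a)\<^sup>2"
    by (simp add: norm_star_eq norm_ip_self power2_eq_square algebra_simps)
  finally show ?thesis by (rule power2_le_imp_le) simp
qed

lemma bounded_linear_act: "bounded_linear (act x)"
proof (rule bounded_linear_intro[where K = "norm x"])
  show "act x (r *\<^sub>R a) = r *\<^sub>R act x a" for r a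
    by (simp add: act_scaleC_right flip: scaleC_of_real)
  show "norm (act x a) \<le> norm a * norm x" for a
    using norm_act_le[of x a] by (simp add: algebra_simps)
qed (rule act_add_right)

lemma theta_apply: "theta act ip x y z = act x (ip y z)"
  by (simp add: theta_def bounded_linear_Blinfun_apply
      bounded_linear_compose[OF bounded_linear_act bounded_linear_ip])

lemma link_op_apply: "link_op act ip T x y a (z, b) = (T z + act x b, ip y z + a * b)"
proof -
  have "bounded_linear (\<lambda>p. (T (fst p) + act x (snd p), ip y (fst p) + a * snd p))"
    by (intro bounded_linear_Pair bounded_linear_add
        bounded_linear_compose[OF blinfun.bounded_linear_right]
        bounded_linear_compose[OF bounded_linear_act]
        bounded_linear_compose[OF bounded_linear_ip]
        bounded_linear_compose[OF bounded_linear_mult_right]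
        bounded_linear_fst bounded_linear_snd)
  then show ?thesis
    by (simp add: link_op_def case_prod_beta' bounded_linear_Blinfun_apply)
qed

lemma link_op_inject:
  "link_op act ip T x y a = link_op act ip T' x' y' a' \<longleftrightarrow> T = T' \<and> x = x' \<and> y = y' \<and> a = a'"
proof
  assume eq: "link_op act ip T x y a = link_op act ip T' x' y' a'"
  have e: "T z + act x b = T' z + act x' b" "ip y z + a * b = ip y' z + a' * b" for z b
    using arg_cong[OF eq, of "\<lambda>F. blinfun_apply F (z, b)"] by (simp_all add: link_op_apply)
  have act0: "act w 0 = 0" for w
    using act_add_right[of w 0 0] by simp
  have "T = T'" using e(1)[of _ 0] by (auto intro: blinfun_eqI simp: act0)
  have acteq: "act x b = act x' b" for b using e(1)[of 0 b] by simp
  have ipeq: "ip y z = ip y' z" for z using e(2)[of z 0] by simp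
  have multeq: "a * b = a' * b" for b using e(2)[of 0 b] by (simp add: ip_zero)
  have ip0: "w = 0" if "ip w w = 0" for w
    using norm_ip_self[of w] that by simp
  have ip_minus_left: "ip (u - v) z = ip u z - ip v z"
    and ip_minus_right: "ip z (u - v) = ip z u - ip z v" for u v z
    using ip_add_left[of "u - v" v z] ip_add_right[of z "u - v" v] by (simp_all add: eq_diff_eq)
  have "y = y'" using ip0[of "y - y'"] ipeq by (simp add: ip_minus_left)
  have cz: "d = 0" if "star d * d = 0" for d :: 'a
    using cstar_identity[of d] that by simp
  have "a = a'"
  proof -
    have "star (star (a - a')) * star (a - a') = 0"
      using multeq by (simp add: star_star left_diff_distrib)
    then have "star (a - a') = 0" by (rule cz)
    then have "norm (a - a') = 0" using norm_star_eq[of "a - a'"] by simp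
    then show ?thesis by simp
  qed
  moreover have "x = x'"
  proof -
    define w where "w = x - x'"
    have "act x b = act w b + act x' b" for b
      using act_add_left[of w x' b] by (simp add: w_def)
    then have "act w b = 0" for b using acteq[of b] by simp
    then have "ip w w * ip w w = 0" by (metis ip_act_right ip_zero(1))
    then have "ip w w = 0" using cz[of "ip w w"] by (simp add: ip_star)
    then have "w = 0" by (rule ip0)
    then show ?thesis by (simp add: w_def)
  qed
  ultimately show "T = T' \<and> x = x' \<and> y = y' \<and> a = a'"
    using \<open>T = T'\<close> \<open>y = y'\<close> by simp
qed auto

end

section \<open>Maps on Hilbert modules and their linking maps\<close>

definition phi_map ::
  "('x \<Rightarrow> 'x \<Rightarrow> 'a) \<Rightarrow> ('a \<Rightarrow> ('h::chilbert_space \<Rightarrow>\<^sub>L 'h)) \<Rightarrow>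
   ('x \<Rightarrow> ('h \<Rightarrow>\<^sub>L 'k::chilbert_space)) \<Rightarrow> bool" where
  "phi_map ip \<phi> \<Phi> \<longleftrightarrow>
     (\<forall>x. \<Phi> x \<in> bdd_ops) \<and> (\<forall>x y. adj (\<Phi> x) o\<^sub>L \<Phi> y = \<phi> (ip x y))"

definition module_ternary_domain ::
  "('x \<Rightarrow> 'a \<Rightarrow> 'x) \<Rightarrow> ('a \<Rightarrow> ('h::chilbert_space \<Rightarrow>\<^sub>L 'h)) \<Rightarrow>
   ('x \<Rightarrow> ('h \<Rightarrow>\<^sub>L 'k::chilbert_space)) \<Rightarrow> 'x set" where
  "module_ternary_domain act \<phi> \<Phi> = {x. \<forall>b. \<Phi> (act x b) = \<Phi> x o\<^sub>L \<phi> b}"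

definition minimal_stinespring ::
  "('x \<Rightarrow> 'x \<Rightarrow> 'a::cstar_algebra) \<Rightarrow>
   ('a \<Rightarrow> ('h::chilbert_space \<Rightarrow>\<^sub>L 'h)) \<Rightarrow> ('x \<Rightarrow> ('h \<Rightarrow>\<^sub>L 'k::chilbert_space)) \<Rightarrow>
   ('a \<Rightarrow> ('h1::chilbert_space \<Rightarrow>\<^sub>L 'h1)) \<Rightarrow> ('x \<Rightarrow> ('h1 \<Rightarrow>\<^sub>L 'k1::chilbert_space)) \<Rightarrow>
   ('h \<Rightarrow>\<^sub>L 'h1) \<Rightarrow> ('k \<Rightarrow>\<^sub>L 'k1) \<Rightarrow> bool" where
  "minimal_stinespring ip \<phi> \<Phi> \<pi> \<Psi> V W \<longleftrightarrow>
     star_representation UNIV (*) star \<pi> \<and> phi_map ip \<pi> \<Psi> \<and>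
     V \<in> bdd_ops \<and> W \<in> bdd_ops \<and> W o\<^sub>L adj W = id_blinfun \<and>
     (\<forall>a. \<phi> a = adj V o\<^sub>L \<pi> a o\<^sub>L V) \<and> closed_cspan {\<pi> a (V h) | a h. True} = UNIV \<and>
     (\<forall>x. \<Phi> x = adj W o\<^sub>L \<Psi> x o\<^sub>L V) \<and> closed_cspan {\<Psi> x (V h) | x h. True} = UNIV"

text \<open>Being a *-representation of \<open>K(X)\<close>, the map \<open>\<sigma>\<close> is determined on \<open>K(X)\<close> by its values on the
  operators \<open>theta\<close>.\<close>

definition compact_representation ::
  "('x::complex_normed_vector \<Rightarrow> 'a \<Rightarrow> 'x) \<Rightarrow> ('x \<Rightarrow> 'x \<Rightarrow> 'a) \<Rightarrow>
   ('x \<Rightarrow> ('h1::chilbert_space \<Rightarrow>\<^sub>L 'k1::chilbert_space)) \<Rightarrow> ('k::chilbert_space \<Rightarrow>\<^sub>L 'k1) \<Rightarrow>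
   (('x \<Rightarrow>\<^sub>L 'x) \<Rightarrow> ('k \<Rightarrow>\<^sub>L 'k)) \<Rightarrow> bool" where
  "compact_representation act ip \<Psi> W \<sigma> \<longleftrightarrow>
     star_representation (compact_ops act ip UNIV) (o\<^sub>L) (adjoint_wrt ip ip) \<sigma> \<and>
     (\<forall>x y. \<sigma> (theta act ip x y) = adj W o\<^sub>L \<Psi> x o\<^sub>L adj (\<Psi> y) o\<^sub>L W)"

text \<open>The matrix entries of an element of the linking algebra are unique by \<open>link_op_inject\<close>.\<close>

definition linking_map ::
  "('x::complex_normed_vector \<Rightarrow> 'a::cstar_algebra \<Rightarrow> 'x) \<Rightarrow> ('x \<Rightarrow> 'x \<Rightarrow> 'a) \<Rightarrow>
   (('x \<Rightarrow>\<^sub>L 'x) \<Rightarrow> ('k::chilbert_space \<Rightarrow>\<^sub>L 'k)) \<Rightarrow> ('x \<Rightarrow> ('h::chilbert_space \<Rightarrow>\<^sub>L 'k)) \<Rightarrow>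
   ('a \<Rightarrow> ('h \<Rightarrow>\<^sub>L 'h)) \<Rightarrow>
   (('x \<times> 'a) \<Rightarrow>\<^sub>L ('x \<times> 'a)) \<Rightarrow> (('k \<times> 'h) \<Rightarrow>\<^sub>L ('k \<times> 'h))" where
  "linking_map act ip \<sigma> \<Phi> \<phi> U =
     (THE R. \<exists>T\<in>compact_ops act ip UNIV. \<exists>x y a. U = link_op act ip T x y a \<and>
        R = block_op (\<sigma> T) (\<Phi> x) (adj (\<Phi> y)) (\<phi> a))"

lemma (in hilbert_module) linking_map_link_op:
  assumes "T \<in> compact_ops act ip UNIV"
  shows "linking_map act ip \<sigma> \<Phi> \<phi> (link_op act ip T x y a) =
    block_op (\<sigma> T) (\<Phi> x) (adj (\<Phi> y)) (\<phi> a)"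
  unfolding linking_map_def using assms by (auto simp: link_op_inject intro!: the_equality)

end

theory Submission
  imports Defs
begin

text \<open>The Stinespring dilation turns every condition of the theorem into a statement about the
  positive operator \<open>P = V V\<^sup>*\<close> on the dilation space \<open>H'\<close>. Writing \<open>\<phi> = V\<^sup>* \<pi> V\<close> and
  \<open>\<Phi> = W\<^sup>* \<Psi> V\<close>, and testing on the vectors \<open>\<pi>(b) V h\<close>, which span a dense subspace of \<open>H'\<close>, one gets

  \<^item> \<open>x \<in> X\<phi>\<close> implies \<open>\<Psi>(x) P = \<Psi>(x)\<close>,
  \<^item> \<open>a \<in> M\<phi>\<close> implies \<open>P \<pi>(a) V = \<pi>(a) V\<close>, and \<open>M\<phi>\<close> is self-adjoint,
  \<^item> \<open>a \<in> T\<phi>\<close> implies \<open>\<pi>(a) P = \<pi>(a)\<close>, and \<open>T\<phi>\<close> is self-adjoint.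

  The other ingredient is that \<open>\<sigma>(T) \<Phi>(x) = \<Phi>(T x)\<close> for every compact \<open>T\<close>
  (\<open>\<sigma>_intertwines_\<Phi>\<close>). On the span of the operators \<open>\<theta>\<close> this is a computation, and continuity of \<open>\<sigma>\<close>
  would extend it; the argument given here is instead algebraic: the defect
  \<open>E = \<sigma>(T) W\<^sup>* \<Psi>(x) - W\<^sup>* \<Psi>(T x)\<close> satisfies \<open>E \<Psi>(v)\<^sup>* = 0\<close> for all \<open>v\<close>, because \<open>T \<theta>\<^sub>x\<^sub>,\<^sub>v\<close> is again
  an operator \<open>\<theta>\<close>. Since \<open>E\<^sup>*\<close> is a sum of terms that begin with some \<open>\<Psi>(v)\<^sup>*\<close>, also \<open>E E\<^sup>* = 0\<close>.

  Multiplying two elements of the linking algebra entrywise, the intertwining relation cancels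
  everything that involves \<open>T\<close>. What is left of \<open>\<phi>t (U U') = \<phi>t U \<phi>t U'\<close> are four equations, one per
  matrix entry (\<open>linking_map_mult_iff\<close>). Off the \<open>(1,1)\<close> entry they are the defining conditions
  of \<open>X\<phi>\<close> and \<open>M\<phi>\<close> or consequences of \<open>a \<in> M\<phi>\<close>; the \<open>(1,1)\<close> entry
  \<open>\<sigma>(\<theta>\<^sub>x\<^sub>,\<^sub>y\<^sub>') = \<Phi>(x) \<Phi>(y')\<^sup>*\<close>, that is, \<open>W\<^sup>* \<Psi>(x) \<Psi>(y')\<^sup>* W = W\<^sup>* \<Psi>(x) P \<Psi>(y')\<^sup>* W\<close>, holds as soon as one
  of \<open>x\<close>, \<open>y'\<close> lies in \<open>X\<phi>\<close>. This gives the multiplicative domain.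

  For the ternary domain let \<open>U\<close> be in the multiplicative domain. Then so is \<open>U\<^sup>*\<close>, hence
  \<open>\<phi>t (U\<^sup>* C) = \<phi>t(U)\<^sup>* \<phi>t(C)\<close>, and the ternary condition says that \<open>\<phi>t\<close> is multiplicative on every product of \<open>B\<close>
  with \<open>D = U\<^sup>* C\<close>. The four equations can then be read off from the entries of \<open>D\<close>.

  Adjoints of bounded operators between Hilbert spaces exist by the Riesz representation theorem; on \<open>X\<close>, where
  it fails, the compact operators have adjoints because the operators \<open>\<theta>\<close> do.\<close>

section \<open>Hilbert spaces: Riesz representation and adjoints\<close>

lemma module_scaleC: "module (scaleC :: complex \<Rightarrow> 'a::complex_normed_vector \<Rightarrow> 'a)"
proof
  show "1 *\<^sub>C x = x" for x :: 'a
    using scaleC_of_real[of 1 x] by simp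
qed (simp_all add: scaleC_add_right scaleC_add_left scaleC_scaleC)

lemmas scaleC_minus_left = module.scale_minus_left[OF module_scaleC]
lemmas scaleC_diff_right = module.scale_right_diff_distrib[OF module_scaleC]
lemmas scaleC_one = module.scale_one[OF module_scaleC]

lemma scaleR_eq_scaleC: "r *\<^sub>R x = complex_of_real r *\<^sub>C (x::'a::complex_normed_vector)"
  by (simp add: scaleC_of_real)

lemma cinner_add_left: "cinner (x + y) z = cinner x z + cinner y (z::'a::chilbert_space)"
  by (metis cinner_add_right cinner_commute complex_cnj_add)

lemma cinner_scaleC_left: "cinner (c *\<^sub>C x) y = cnj c * cinner x (y::'a::chilbert_space)"
  by (metis cinner_scaleC_right cinner_commute complex_cnj_mult)

lemma cinner_minus_right: "cinner x (- y) = - cinner x (y::'a::chilbert_space)"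
  using cinner_scaleC_right[of x "-1" y] by (simp add: scaleC_minus_left scaleC_one)

lemma cinner_minus_left: "cinner (- x) y = - cinner x (y::'a::chilbert_space)"
  using cinner_scaleC_left[of "-1" x y] by (simp add: scaleC_minus_left scaleC_one)

lemma cinner_diff_right: "cinner x (y - z) = cinner x y - cinner x (z::'a::chilbert_space)"
  using cinner_add_right[of x y "- z"] by (simp add: cinner_minus_right)

lemma cinner_diff_left: "cinner (x - y) z = cinner x z - cinner y (z::'a::chilbert_space)"
  using cinner_add_left[of x "- y" z] by (simp add: cinner_minus_left)

lemma cinner_self_eq_0: "cinner x x = 0 \<longleftrightarrow> x = (0::'a::chilbert_space)"
  by (simp add: cinner_self)

lemma cinner_nondegenerate:
  assumes "\<And>u. cinner u w = cinner u w'"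
  shows "w = (w'::'a::chilbert_space)"
proof -
  have "cinner (w - w') (w - w') = 0"
    using assms[of "w - w'"] by (simp add: cinner_diff_right)
  then show ?thesis by (simp add: cinner_self_eq_0)
qed

lemma norm_add_square:
  "(norm (x + y))\<^sup>2 = (norm x)\<^sup>2 + (norm y)\<^sup>2 + 2 * Re (cinner x (y::'a::chilbert_space))"
proof -
  have "cinner (x + y) (x + y) = cinner x x + cinner y y + (cinner x y + cnj (cinner x y))"
    using cinner_commute[of y x] by (simp add: cinner_add_left cinner_add_right)
  then have "Re (cinner (x + y) (x + y)) = Re (cinner x x + cinner y y + (cinner x y + cnj (cinner x y)))"
    by simp
  then show ?thesis by (simp add: cinner_self)
qed

text \<open>The representing vector minimizes \<open>J x = \<parallel>x\<parallel>\<^sup>2 - 2 Re (f x)\<close>: by the parallelogram law a minimizing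
  sequence is Cauchy, and the first variation of \<open>J\<close> at the minimum says \<open>Re (f u) = Re \<langle>w, u\<rangle>\<close>.
  Replacing \<open>u\<close> by \<open>\<i> u\<close> gives the imaginary parts.\<close>

lemma riesz_representation:
  fixes f :: "'h::chilbert_space \<Rightarrow> complex"
  assumes add: "\<And>x y. f (x + y) = f x + f y"
    and scale: "\<And>c x. f (c *\<^sub>C x) = c * f x"
    and bound: "\<And>x. cmod (f x) \<le> B * norm x"
  shows "\<exists>w. \<forall>u. f u = cinner w u"
proof -
  define J where "J x = (norm x)\<^sup>2 - 2 * Re (f x)" for x
  have fR: "f (r *\<^sub>R x) = complex_of_real r * f x" for r x
    by (simp add: scaleR_eq_scaleC scale)
  have fbl: "bounded_linear f"
    by (rule bounded_linear_intro[where K = B])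
      (simp_all add: add fR bound mult.commute scaleR_conv_of_real)
  have "J x \<ge> - B\<^sup>2" for x
  proof -
    have "Re (f x) \<le> B * norm x" using bound[of x] complex_Re_le_cmod order_trans by blast
    moreover have "0 \<le> (norm x - B)\<^sup>2" by simp
    ultimately show ?thesis by (simp add: J_def power2_eq_square algebra_simps)
  qed
  then have bdd: "bdd_below (range J)" by (meson bdd_belowI2)
  define m where "m = Inf (range J)"
  have mle: "m \<le> J x" for x unfolding m_def by (rule cINF_lower[OF bdd]) simp
  have "\<exists>x. J x < m + 1 / real (Suc n)" for n
  proof -
    have "Inf (range J) < m + 1 / real (Suc n)" by (simp add: m_def)
    then show ?thesis using cInf_less_iff[OF _ bdd] by auto
  qed
  then obtain X where X: "\<And>n. J (X n) < m + 1 / real (Suc n)" by metis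
  have par: "(norm (x - y))\<^sup>2 = 2 * J x + 2 * J y - 4 * J ((1/2) *\<^sub>R (x + y))" for x y
  proof -
    have "(norm (x - y))\<^sup>2 = (norm x)\<^sup>2 + (norm y)\<^sup>2 - 2 * Re (cinner x y)"
      using norm_add_square[of x "- y"] by (simp add: cinner_minus_right)
    moreover have "J ((1/2) *\<^sub>R (x + y)) = (norm (x + y))\<^sup>2 / 4 - (Re (f x) + Re (f y))"
      by (simp add: J_def fR add power_divide add_divide_distrib)
    ultimately show ?thesis
      by (simp add: J_def norm_add_square field_simps)
  qed
  have dist: "(norm (X n - X k))\<^sup>2 \<le> 2 * (1 / real (Suc n)) + 2 * (1 / real (Suc k))" for n k
    unfolding par using X[of n] X[of k] mle[of "(1/2) *\<^sub>R (X n + X k)"] by linarith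
  have "Cauchy X"
  proof (rule CauchyI)
    fix e :: real assume "e > 0"
    then obtain N where N: "1 / real (Suc N) < e\<^sup>2 / 4"
      using nat_approx_posE[of "e\<^sup>2 / 4"] by auto
    have "norm (X n - X k) < e" if "n \<ge> N" "k \<ge> N" for n k
    proof -
      have "1 / real (Suc j) \<le> 1 / real (Suc N)" if "j \<ge> N" for j
        using that by (simp add: field_simps)
      from this[OF \<open>n \<ge> N\<close>] this[OF \<open>k \<ge> N\<close>] have "(norm (X n - X k))\<^sup>2 < e\<^sup>2"
        using dist[of n k] N by linarith
      then show ?thesis using \<open>e > 0\<close> by (simp add: power_less_imp_less_base)
    qed
    then show "\<exists>M. \<forall>n\<ge>M. \<forall>k\<ge>M. norm (X n - X k) < e" by blast
  qed
  then obtain w where w: "X \<longlonglongrightarrow> w" by (auto simp: Cauchy_convergent_iff convergent_def)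
  have "(\<lambda>n. J (X n)) \<longlonglongrightarrow> J w"
    unfolding J_def by (intro tendsto_intros w bounded_linear.tendsto[OF fbl])
  moreover have "(\<lambda>n. m + 1 / real (Suc n)) \<longlonglongrightarrow> m + 0"
    by (intro tendsto_intros LIMSEQ_inverse_real_of_nat[unfolded inverse_eq_divide])
  ultimately have "J w \<le> m + 0"
    by (rule LIMSEQ_le) (use X less_imp_le in blast)
  then have "J w \<le> m" by simp
  have reeq: "Re (f u) = Re (cinner w u)" for u
  proof -
    define d where "d = Re (cinner w u) - Re (f u)"
    \<comment> \<open>any \<open>t\<close> proportional to \<open>- d\<close> and small enough makes the variation negative; the added \<open>1\<close>
      covers \<open>u = 0\<close>\<close>
    define t where "t = - d / ((norm u)\<^sup>2 + 1)"
    have pos: "(norm u)\<^sup>2 + 1 > 0" by (simp add: add_nonneg_pos)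
    have "J w \<le> J (w + t *\<^sub>R u)" using \<open>J w \<le> m\<close> mle order_trans by blast
    then have "0 \<le> t\<^sup>2 * (norm u)\<^sup>2 + 2 * t * d"
      by (simp add: J_def add fR norm_add_square d_def power_mult_distrib scaleR_eq_scaleC
          cinner_scaleC_right norm_scaleC scale algebra_simps)
    then have "0 \<le> (t\<^sup>2 * (norm u)\<^sup>2 + 2 * t * d) * ((norm u)\<^sup>2 + 1)\<^sup>2" by simp
    moreover have td: "t * ((norm u)\<^sup>2 + 1) = - d" using pos by (simp add: t_def)
    have "(t\<^sup>2 * (norm u)\<^sup>2 + 2 * t * d) * ((norm u)\<^sup>2 + 1)\<^sup>2
      = (t * ((norm u)\<^sup>2 + 1))\<^sup>2 * (norm u)\<^sup>2 + 2 * (t * ((norm u)\<^sup>2 + 1)) * d * ((norm u)\<^sup>2 + 1)"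
      by algebra
    then have "(t\<^sup>2 * (norm u)\<^sup>2 + 2 * t * d) * ((norm u)\<^sup>2 + 1)\<^sup>2 = - (d\<^sup>2 * ((norm u)\<^sup>2 + 2))"
      unfolding td by algebra
    ultimately have "d\<^sup>2 * ((norm u)\<^sup>2 + 2) \<le> 0" by simp
    moreover have "(norm u)\<^sup>2 + 2 > 0" by (simp add: add_nonneg_pos)
    ultimately have "d\<^sup>2 \<le> 0" by (simp add: mult_le_0_iff)
    then show ?thesis by (simp add: d_def)
  qed
  have "f u = cinner w u" for u
  proof (rule complex_eqI[OF reeq])
    show "Im (f u) = Im (cinner w u)"
      using reeq[of "\<i> *\<^sub>C u"] by (simp add: scale cinner_scaleC_right)
  qed
  then show ?thesis by blast
qed

text \<open>Weaker than Cauchy-Schwarz by the factor \<open>2\<close>, which comes from estimating the real and the imaginary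
  part separately.\<close>

lemma norm_cinner_le: "cmod (cinner x y) \<le> 2 * norm x * norm (y::'a::chilbert_space)"
proof -
  have re: "Re (cinner x y) \<le> norm x * norm y" for x y :: 'a
  proof -
    have "(norm (x + y))\<^sup>2 \<le> (norm x + norm y)\<^sup>2"
      by (intro power_mono norm_triangle_ineq norm_ge_zero)
    then show ?thesis by (simp add: norm_add_square power2_sum)
  qed
  have absre: "\<bar>Re (cinner x y)\<bar> \<le> norm x * norm y" for x y :: 'a
    using re[of x y] re[of x "- y"] by (simp add: cinner_minus_right)
  have "\<bar>Im (cinner x y)\<bar> \<le> norm x * norm y"
    using absre[of x "\<i> *\<^sub>C y"] by (simp add: cinner_scaleC_right norm_scaleC)
  then show ?thesis
    using cmod_le[of "cinner x y"] absre[of x y] by simp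
qed

lemma adjoint_wrt_eqI:
  assumes "\<And>w w'. (\<And>u. ipX u w = ipX u w') \<Longrightarrow> w = w'"
    and "\<And>u v. ipY (blinfun_apply F u) v = ipX u (blinfun_apply G v)"
  shows "adjoint_wrt ipX ipY F = G"
  unfolding adjoint_wrt_def
proof (rule the_equality)
  fix G' assume G': "\<forall>u v. ipY (blinfun_apply F u) v = ipX u (blinfun_apply G' v)"
  show "G' = G" by (rule blinfun_eqI, rule assms(1)) (metis G' assms(2))
qed (use assms(2) in blast)

text \<open>Linearity and boundedness of an adjoint are automatic, whatever its origin: linearity by
  nondegeneracy, boundedness by testing on \<open>u = g v\<close>. The inner products take values in a normed space,
  so that Hilbert spaces and Hilbert modules are both covered.\<close>

lemma formal_adjoint_bounded:
  fixes ipX :: "'x::real_normed_vector \<Rightarrow> 'x \<Rightarrow> 'b::real_normed_vector"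
    and ipY :: "'y::real_normed_vector \<Rightarrow> 'y \<Rightarrow> 'b"
    and F :: "'x \<Rightarrow>\<^sub>L 'y"
  assumes nondeg: "\<And>w w'. (\<And>u. ipX u w = ipX u w') \<Longrightarrow> w = w'"
    and lin1: "\<And>u. linear (ipX u)" and lin2: "\<And>u. linear (ipY u)"
    and self: "\<And>x. norm (ipX x x) = (norm x)\<^sup>2"
    and bound: "\<And>u v. norm (ipY u v) \<le> C * norm u * norm v" and "C \<ge> 0"
    and adj: "\<And>u v. ipY (F u) v = ipX u (g v)"
  shows "bounded_linear g" "norm (g v) \<le> C * norm F * norm v"
proof -
  show le: "norm (g v) \<le> C * norm F * norm v" for v
  proof (cases "g v = 0")
    case False
    have "(norm (g v))\<^sup>2 \<le> C * norm (F (g v)) * norm v"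
      using bound[of "F (g v)" v] by (simp add: adj self)
    also have "\<dots> \<le> C * (norm F * norm (g v)) * norm v"
      using \<open>C \<ge> 0\<close> by (intro mult_right_mono mult_left_mono norm_blinfun) auto
    finally show ?thesis using False by (simp add: power2_eq_square)
  qed (use \<open>C \<ge> 0\<close> in simp)
  show "bounded_linear g"
  proof (rule bounded_linear_intro[where K = "C * norm F"])
    show "g (x + y) = g x + g y" for x y
      by (rule nondeg) (simp add: linear_add[OF lin1] linear_add[OF lin2] flip: adj)
    show "g (r *\<^sub>R x) = r *\<^sub>R g x" for r x
      by (rule nondeg) (simp add: linear_scale[OF lin1] linear_scale[OF lin2] flip: adj)
    show "norm (g x) \<le> norm x * (C * norm F)" for x
      using le[of x] by (simp add: mult.commute)
  qed
qed

lemma linear_cinner: "linear (cinner (u::'a::chilbert_space))"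
  by (rule linearI) (simp_all add: cinner_add_right scaleR_eq_scaleC cinner_scaleC_right scaleR_conv_of_real)

lemma cinner_adj:
  fixes F :: "'h::chilbert_space \<Rightarrow>\<^sub>L 'k::chilbert_space"
  assumes F: "F \<in> bdd_ops"
  shows "cinner (F u) v = cinner u (adj F v)"
proof -
  have "\<exists>w. \<forall>u. cinner v (F u) = cinner w u" for v
  proof (rule riesz_representation[where B = "2 * norm v * norm F"])
    show "cmod (cinner v (F x)) \<le> 2 * norm v * norm F * norm x" for x
      using norm_cinner_le[of v "F x"] mult_left_mono[OF norm_blinfun[of F x], of "2 * norm v"]
      by (simp add: mult.assoc)
  qed (use F in \<open>simp_all add: bdd_ops_def blinfun.add_right cinner_add_right cinner_scaleC_right\<close>)
  then obtain g where "\<And>u v. cinner v (F u) = cinner (g v) u" by metis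
  then have g: "cinner (F u) v = cinner u (g v)" for u v
    by (metis cinner_commute)
  have "bounded_linear g"
    by (rule formal_adjoint_bounded[where ipX = cinner and ipY = cinner and F = F and C = 2])
      (auto intro: cinner_nondegenerate norm_cinner_le linear_cinner simp: g cinner_self norm_power)
  then have G: "cinner (F u) v = cinner u (Blinfun g v)" for u v
    by (simp add: g bounded_linear_Blinfun_apply)
  then have "adj F = Blinfun g"
    by (intro adjoint_wrt_eqI cinner_nondegenerate)
  then show ?thesis using G by simp
qed

lemma cinner_adj_left:
  assumes "F \<in> bdd_ops"
  shows "cinner (adj F v) u = cinner v (F u)"
  by (metis assms cinner_adj cinner_commute)

lemma adj_eqI:
  assumes "\<And>u v. cinner (blinfun_apply F u) v = cinner u (blinfun_apply G v)"
  shows "adj F = G"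
  using assms by (intro adjoint_wrt_eqI cinner_nondegenerate)

lemma bdd_ops_scaleC: "F \<in> bdd_ops \<Longrightarrow> F (c *\<^sub>C x) = c *\<^sub>C F x"
  by (simp add: bdd_ops_def)

lemma adj_in_bdd_ops [simp, intro]:
  assumes "F \<in> bdd_ops"
  shows "adj F \<in> bdd_ops"
proof -
  have "adj F (c *\<^sub>C x) = c *\<^sub>C adj F x" for c x
    by (rule cinner_nondegenerate)
      (simp add: cinner_adj[OF assms, symmetric] cinner_scaleC_right)
  then show ?thesis by (simp add: bdd_ops_def)
qed

lemma compose_in_bdd_ops [simp, intro]: "F \<in> bdd_ops \<Longrightarrow> G \<in> bdd_ops \<Longrightarrow> F o\<^sub>L G \<in> bdd_ops"
  by (simp add: bdd_ops_def)

lemma diff_in_bdd_ops [simp, intro]: "F \<in> bdd_ops \<Longrightarrow> G \<in> bdd_ops \<Longrightarrow> F - G \<in> bdd_ops"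
  by (simp add: bdd_ops_def blinfun.diff_left scaleC_diff_right)

lemma adj_adj [simp]: "F \<in> bdd_ops \<Longrightarrow> adj (adj F) = F"
  by (rule adj_eqI) (simp add: cinner_adj_left)

lemma adj_compose: "F \<in> bdd_ops \<Longrightarrow> G \<in> bdd_ops \<Longrightarrow> adj (F o\<^sub>L G) = adj G o\<^sub>L adj F"
  by (rule adj_eqI) (simp add: cinner_adj)

lemma adj_add: "F \<in> bdd_ops \<Longrightarrow> G \<in> bdd_ops \<Longrightarrow> adj (F + G) = adj F + adj G"
  by (rule adj_eqI) (simp add: cinner_adj cinner_add_left cinner_add_right blinfun.add_left)

lemma adj_diff: "F \<in> bdd_ops \<Longrightarrow> G \<in> bdd_ops \<Longrightarrow> adj (F - G) = adj F - adj G"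
  by (rule adj_eqI) (simp add: cinner_adj cinner_diff_left cinner_diff_right blinfun.diff_left)

lemma adj_inject: "F \<in> bdd_ops \<Longrightarrow> G \<in> bdd_ops \<Longrightarrow> adj F = adj G \<longleftrightarrow> F = G"
  by (metis adj_adj)

text \<open>The reason is \<open>\<parallel>F x\<parallel>\<^sup>2 = \<langle>x, F\<^sup>* F x\<rangle>\<close>. Identities between operators are proved below by applying this to the
  difference of the two sides.\<close>

lemma eq_zero_if_adj_compose_zero:
  assumes "F \<in> bdd_ops" "adj F o\<^sub>L F = 0"
  shows "F = 0"
proof (rule blinfun_eqI)
  fix x
  have "cinner (F x) (F x) = cinner x ((adj F o\<^sub>L F) x)" by (simp add: cinner_adj assms(1))
  then have "cinner (F x) (F x) = 0" by (simp add: assms(2) linear_0[OF linear_cinner])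
  then show "F x = blinfun_apply 0 x" by (simp add: cinner_self_eq_0)
qed

lemma bdd_ops_eqI_total:
  assumes "F \<in> bdd_ops" "G \<in> bdd_ops" and total: "closed_cspan S = UNIV"
    and eq: "\<And>s. s \<in> S \<Longrightarrow> F s = G s"
  shows "F = G"
proof (rule blinfun_eqI)
  fix x
  have "F y = G y" if "y \<in> module.span scaleC S" for y
    using that
  proof (induction rule: module.span_induct_alt[OF module_scaleC, consumes 1])
    case (2 c z y)
    then show ?case using assms by (simp add: blinfun.add_right bdd_ops_scaleC)
  qed simp
  moreover have "closed {y. F y = G y}"
    by (intro closed_Collect_eq continuous_intros)
  ultimately have "closed_cspan S \<subseteq> {y. F y = G y}"
    unfolding closed_cspan_def by (intro closure_minimal) auto
  then show "F x = G x" using total by auto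
qed

lemma compose_assoc: "(F o\<^sub>L G) o\<^sub>L H = F o\<^sub>L (G o\<^sub>L H)"
  by (rule blinfun_eqI) simp

lemma id_compose [simp]: "id_blinfun o\<^sub>L F = F" "F o\<^sub>L id_blinfun = F"
  by (rule blinfun_eqI, simp)+

lemmas compose_diff_left = bounded_bilinear.diff_left[OF bounded_bilinear_blinfun_compose]
lemmas compose_diff_right = bounded_bilinear.diff_right[OF bounded_bilinear_blinfun_compose]
lemmas compose_add_left = bounded_bilinear.add_left[OF bounded_bilinear_blinfun_compose]
lemmas compose_add_right = bounded_bilinear.add_right[OF bounded_bilinear_blinfun_compose]

lemma block_op_compose:
  "block_op P Q R S o\<^sub>L block_op P' Q' R' S' =
    block_op ((P o\<^sub>L P') + (Q o\<^sub>L R')) ((P o\<^sub>L Q') + (Q o\<^sub>L S'))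
      ((R o\<^sub>L P') + (S o\<^sub>L R')) ((R o\<^sub>L Q') + (S o\<^sub>L S'))"
  by (rule blinfun_eqI)
    (auto simp: block_op_apply blinfun.add_right blinfun.add_left split: prod.splits)

lemma block_op_inject:
  "block_op P Q R S = block_op P' Q' R' S' \<longleftrightarrow> P = P' \<and> Q = Q' \<and> R = R' \<and> S = S'"
proof
  assume "block_op P Q R S = block_op P' Q' R' S'"
  then have e: "block_op P Q R S (k, h) = block_op P' Q' R' S' (k, h)" for k h by simp
  show "P = P' \<and> Q = Q' \<and> R = R' \<and> S = S'"
    using e[of _ 0] e[of 0] by (auto simp: block_op_apply intro!: blinfun_eqI)
qed simp

lemma adj_block_op:
  assumes "P \<in> bdd_ops" "Q \<in> bdd_ops" "R \<in> bdd_ops" "S \<in> bdd_ops"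
  shows "adj (block_op P Q R S) = block_op (adj P) (adj R) (adj Q) (adj S)"
  by (rule adj_eqI) (use assms in \<open>auto simp: block_op_apply cinner_prod_def cinner_add_left
    cinner_add_right cinner_adj split: prod.splits\<close>)

section \<open>Compact operators and the linking algebra of a Hilbert module\<close>

context hilbert_module
begin

lemma linear_ip: "linear (ip u)"
  using bounded_linear_ip by (rule bounded_linear.linear)

lemma linear_ip_left: "linear (\<lambda>u. ip u v)"
  by (rule linearI) (simp_all add: ip_add_left scaleR_eq_scaleC ip_scaleC_left)

lemma bounded_linear_ip_left: "bounded_linear (\<lambda>u. ip u v)"
  by (rule bounded_linear_intro[where K = "4 * norm v"])
    (use norm_ip_le[of _ v] in
      \<open>simp_all add: linear_add[OF linear_ip_left] linear_scale[OF linear_ip_left] algebra_simps\<close>)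

lemma ip_act_left: "ip (act x a) y = star a * ip x y"
  by (metis ip_act_right ip_star star_mult)

lemma ip_nondegenerate:
  assumes "\<And>u. ip u w = ip u w'"
  shows "w = w'"
proof -
  have "ip (w - w') (w - w') = 0"
    using assms[of "w - w'"] by (simp add: linear_diff[OF linear_ip])
  then show ?thesis using norm_ip_self[of "w - w'"] by simp
qed

lemma star_mult_cancel:
  assumes "\<And>b. star b * w = star b * (w' :: 'a)"
  shows "w = w'"
proof -
  have "star (w - w') * (w - w') = 0"
    using assms[of "w - w'"] by (simp add: right_diff_distrib)
  then show ?thesis using cstar_identity[of "w - w'"] by simp
qed

text \<open>On a Hilbert module an adjoint need not exist, so it is carried along as a second operator.\<close>

definition adjoint_pair :: "('x \<Rightarrow>\<^sub>L 'x) \<Rightarrow> ('x \<Rightarrow>\<^sub>L 'x) \<Rightarrow> bool" where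
  "adjoint_pair T S \<longleftrightarrow> (\<forall>u v. ip (T u) v = ip u (S v))"

lemma adjoint_pair_sym: "adjoint_pair T S \<Longrightarrow> adjoint_pair S T"
  unfolding adjoint_pair_def by (metis ip_star)

lemma adjoint_wrt_adjoint_pair: "adjoint_pair T S \<Longrightarrow> adjoint_wrt ip ip T = S"
  unfolding adjoint_pair_def by (blast intro: adjoint_wrt_eqI ip_nondegenerate)

lemma adjoint_pair_right: "adjoint_pair T S \<Longrightarrow> ip u (T v) = ip (S u) v"
  using adjoint_pair_sym[of T S] by (simp add: adjoint_pair_def)

lemma adjoint_pair_act: "adjoint_pair T S \<Longrightarrow> T (act x a) = act (T x) a"
  by (rule ip_nondegenerate) (simp add: adjoint_pair_right ip_act_right)

lemma adjoint_pair_scaleC: "adjoint_pair T S \<Longrightarrow> T (c *\<^sub>C x) = c *\<^sub>C T x"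
  by (rule ip_nondegenerate) (simp add: adjoint_pair_right ip_scaleC_right)

lemma norm_formal_adjoint_le:
  assumes "\<And>u v. ip (blinfun_apply T u) v = ip u (g v)"
  shows "bounded_linear g" "norm (g v) \<le> 4 * norm T * norm v"
proof -
  note * = formal_adjoint_bounded[where ipX = ip and ipY = ip and F = T and g = g and C = 4]
  show "bounded_linear g"
    by (rule *(1)) (rule ip_nondegenerate linear_ip norm_ip_self norm_ip_le assms zero_le_numeral | assumption)+
  show "norm (g v) \<le> 4 * norm T * norm v"
    by (rule *(2)) (rule ip_nondegenerate linear_ip norm_ip_self norm_ip_le assms zero_le_numeral | assumption)+
qed

text \<open>The trivial membership conditions make this literally the generating set in \<open>compact_ops\<close>.\<close>

abbreviation thetas :: "('x \<Rightarrow>\<^sub>L 'x) set" where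
  "thetas \<equiv> {theta act ip x y | x y. x \<in> UNIV \<and> y \<in> UNIV}"

abbreviation K :: "('x \<Rightarrow>\<^sub>L 'x) set" where
  "K \<equiv> compact_ops act ip UNIV"

lemma compact_sequential:
  "T \<in> K \<longleftrightarrow> (\<exists>t. (\<forall>n. t n \<in> module.span scaleC thetas) \<and> t \<longlonglongrightarrow> T)"
  unfolding compact_ops_def closed_cspan_def by (rule closure_sequential)

lemma span_thetas_subset_compact: "module.span scaleC thetas \<subseteq> K"
  unfolding compact_ops_def closed_cspan_def by (rule closure_subset)

lemma adjoint_pair_theta: "adjoint_pair (theta act ip x y) (theta act ip y x)"
  unfolding adjoint_pair_def theta_apply ip_act_left ip_act_right by (simp add: ip_star)

lemma theta_in_compact [simp, intro]: "theta act ip x y \<in> K"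
  using span_thetas_subset_compact module.span_base[OF module_scaleC, of "theta act ip x y" thetas]
  by blast

lemma zero_in_compact [simp, intro]: "0 \<in> K"
  using span_thetas_subset_compact module.span_zero[OF module_scaleC] by blast

lemma add_in_compact [simp, intro]:
  assumes "S \<in> K" "T \<in> K"
  shows "S + T \<in> K"
proof -
  obtain s t where "\<And>n. s n \<in> module.span scaleC thetas" "s \<longlonglongrightarrow> S"
      "\<And>n. t n \<in> module.span scaleC thetas" "t \<longlonglongrightarrow> T"
    using assms unfolding compact_sequential by blast
  then show ?thesis
    unfolding compact_sequential
    by (intro exI[of _ "\<lambda>n. s n + t n"])
      (auto intro: module.span_add[OF module_scaleC] tendsto_add)
qed

lemma span_thetas_adjoint:
  assumes "T \<in> module.span scaleC thetas"
  shows "\<exists>S\<in>module.span scaleC thetas. adjoint_pair T S"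
  using assms
proof (induction rule: module.span_induct_alt[OF module_scaleC, consumes 1])
  case 1
  have "adjoint_pair 0 0" by (simp add: adjoint_pair_def ip_zero)
  then show ?case using module.span_zero[OF module_scaleC] by blast
next
  case (2 c T U)
  then obtain x y U' where T: "T = theta act ip x y"
    and U': "U' \<in> module.span scaleC thetas" "adjoint_pair U U'" by blast
  have "cnj c *\<^sub>C theta act ip y x + U' \<in> module.span scaleC thetas"
    by (intro module.span_add[OF module_scaleC] module.span_scale[OF module_scaleC]
        module.span_base[OF module_scaleC] U') blast
  moreover have "adjoint_pair (c *\<^sub>C T + U) (cnj c *\<^sub>C theta act ip y x + U')"
    using adjoint_pair_theta[of x y] U'(2)
    by (simp add: T adjoint_pair_def blinfun.add_left scaleC_blinfun_apply ip_add_left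
        ip_add_right ip_scaleC_left ip_scaleC_right)
  ultimately show ?case by blast
qed

text \<open>An adjoint \<open>S\<close> of the limit \<open>T\<close> of \<open>t\<^sub>n\<close> is found as the pointwise limit of the adjoints \<open>s\<^sub>n\<close>. The bound on
  formal adjoints, applied to the differences \<open>t\<^sub>n - t\<^sub>m\<close> and \<open>t\<^sub>n - T\<close>, first shows that the pointwise
  limit exists and then that \<open>s\<^sub>n\<close> converges to \<open>S\<close> in norm, which makes \<open>S\<close> compact.\<close>

lemma compact_adjoint:
  assumes "T \<in> K"
  obtains S where "S \<in> K" "adjoint_pair T S"
proof -
  obtain t where t: "\<And>n. t n \<in> module.span scaleC thetas" and lim: "t \<longlonglongrightarrow> T"
    using assms unfolding compact_sequential by blast
  have "\<forall>n. \<exists>S. S \<in> module.span scaleC thetas \<and> adjoint_pair (t n) S"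
    using span_thetas_adjoint[OF t] by blast
  from choice[OF this] obtain s where s: "\<And>n. s n \<in> module.span scaleC thetas"
    and pair: "\<And>n. adjoint_pair (t n) (s n)" by blast
  have diff: "norm (s n v - s m v) \<le> 4 * norm (t n - t m) * norm v" for n m v
  proof (rule norm_formal_adjoint_le(2))
    show "ip ((t n - t m) u) v = ip u (s n v - s m v)" for u v
      using pair by (simp add: adjoint_pair_def blinfun.diff_left linear_diff[OF linear_ip]
        linear_diff[OF linear_ip_left])
  qed
  have cau: "Cauchy (\<lambda>n. s n v)" for v
  proof (rule CauchyI)
    fix e :: real assume "e > 0"
    have "Cauchy t" using lim by (rule LIMSEQ_imp_Cauchy)
    then obtain M where M: "\<And>m n. m \<ge> M \<Longrightarrow> n \<ge> M \<Longrightarrow> norm (t m - t n) < e / (4 * norm v + 1)"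
      using \<open>e > 0\<close> CauchyD[of t "e / (4 * norm v + 1)"] by (auto simp: add_nonneg_pos)
    have "norm (s m v - s n v) < e" if "m \<ge> M" "n \<ge> M" for m n
    proof -
      have "norm (s m v - s n v) \<le> norm (t m - t n) * (4 * norm v)"
        using diff[of m v n] by (simp add: algebra_simps)
      also have "\<dots> \<le> norm (t m - t n) * (4 * norm v + 1)" by (intro mult_left_mono) auto
      also have "\<dots> < e" using M[OF that] by (simp add: pos_less_divide_eq add_nonneg_pos)
      finally show ?thesis .
    qed
    then show "\<exists>M. \<forall>m\<ge>M. \<forall>n\<ge>M. norm (s m v - s n v) < e" by blast
  qed
  define g where "g v = lim (\<lambda>n. s n v)" for v
  have g: "(\<lambda>n. s n v) \<longlonglongrightarrow> g v" for v
    unfolding g_def using cau[of v] by (simp add: Cauchy_convergent_iff convergent_LIMSEQ_iff)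
  have adj: "ip (T u) v = ip u (g v)" for u v
  proof (rule LIMSEQ_unique)
    show "(\<lambda>n. ip (t n u) v) \<longlonglongrightarrow> ip (T u) v"
      by (intro bounded_linear.tendsto[OF bounded_linear_ip_left] tendsto_intros lim)
    show "(\<lambda>n. ip (t n u) v) \<longlonglongrightarrow> ip u (g v)"
      using pair bounded_linear.tendsto[OF bounded_linear_ip g] by (simp add: adjoint_pair_def)
  qed
  define S where "S = Blinfun g"
  have Sg: "S v = g v" for v
    by (simp add: S_def bounded_linear_Blinfun_apply norm_formal_adjoint_le(1)[OF adj])
  have le: "norm (s n - S) \<le> 4 * norm (t n - T)" for n
  proof (rule norm_blinfun_bound)
    have "ip ((t n - T) u) v = ip u ((s n - S) v)" for u v
      using pair by (simp add: adjoint_pair_def blinfun.diff_left linear_diff[OF linear_ip]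
        linear_diff[OF linear_ip_left] adj Sg)
    then show "norm ((s n - S) v) \<le> 4 * norm (t n - T) * norm v" for v
      by (rule norm_formal_adjoint_le(2))
  qed simp
  have "(\<lambda>n. 4 * norm (t n - T)) \<longlonglongrightarrow> 0"
    using lim by (intro tendsto_mult_right_zero) (simp add: LIM_zero tendsto_norm_zero)
  then have "(\<lambda>n. s n - S) \<longlonglongrightarrow> 0"
    by (rule Lim_null_comparison[rotated]) (simp add: le)
  then have "s \<longlonglongrightarrow> S" by (rule LIM_zero_cancel)
  then have "S \<in> K"
    unfolding compact_sequential using s by blast
  moreover have "adjoint_pair T S" by (simp add: adjoint_pair_def adj Sg)
  ultimately show ?thesis by (rule that)
qed

lemma compose_theta:
  assumes "adjoint_pair T S"
  shows "T o\<^sub>L theta act ip x y = theta act ip (T x) y"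
  by (rule blinfun_eqI) (simp add: theta_apply adjoint_pair_act[OF assms])

lemma compose_in_compact [simp, intro]:
  assumes "S \<in> K" "T \<in> K"
  shows "S o\<^sub>L T \<in> K"
proof -
  obtain S' where S': "adjoint_pair S S'" using compact_adjoint assms(1) by blast
  have "S o\<^sub>L U \<in> module.span scaleC thetas" if "U \<in> module.span scaleC thetas" for U
    using that
  proof (induction rule: module.span_induct_alt[OF module_scaleC, consumes 1])
    case 1
    then show ?case by (simp add: module.span_zero[OF module_scaleC])
  next
    case (2 c V U)
    then obtain x y where V: "V = theta act ip x y" by blast
    have "S o\<^sub>L (c *\<^sub>C V + U) = c *\<^sub>C theta act ip (S x) y + (S o\<^sub>L U)"
      by (rule blinfun_eqI)
        (simp add: V blinfun.add_left blinfun.add_right scaleC_blinfun_apply theta_apply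
          adjoint_pair_act[OF S'] adjoint_pair_scaleC[OF S'])
    moreover have "c *\<^sub>C theta act ip (S x) y + (S o\<^sub>L U) \<in> module.span scaleC thetas"
      by (intro module.span_add[OF module_scaleC] module.span_scale[OF module_scaleC]
          module.span_base[OF module_scaleC] 2) blast
    ultimately show ?case by simp
  qed
  moreover have "continuous_on A (\<lambda>U. S o\<^sub>L U)" for A :: "('x \<Rightarrow>\<^sub>L 'x) set"
    by (intro continuous_intros)
  ultimately have "(\<lambda>U. S o\<^sub>L U) ` K \<subseteq> K"
    unfolding compact_ops_def closed_cspan_def
    by (intro image_closure_subset) (use closure_subset in auto)
  then show ?thesis using assms(2) by blast
qed

text \<open>Multiplication and involution of the linking algebra, in terms of matrix entries. The lower left entry
  is stored through the vector \<open>y\<close> of \<open>y\<^sup>*\<close>, which is why the adjoints \<open>S'\<close> and \<open>star a\<close> act on it.\<close>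

lemma link_op_compose:
  assumes T: "adjoint_pair T S" and T': "adjoint_pair T' S'"
  shows "link_op act ip T x y a o\<^sub>L link_op act ip T' x' y' a' =
    link_op act ip ((T o\<^sub>L T') + theta act ip x y') (T x' + act x a')
      (S' y + act y' (star a)) (ip y x' + a * a')"
proof (rule blinfun_eqI)
  fix p :: "'x \<times> 'a"
  obtain z b where p: "p = (z, b)" by (cases p)
  have "ip y (T' z) = ip (S' y) z"
    using adjoint_pair_sym[OF T'] by (simp add: adjoint_pair_def)
  then show "(link_op act ip T x y a o\<^sub>L link_op act ip T' x' y' a') p =
    link_op act ip ((T o\<^sub>L T') + theta act ip x y') (T x' + act x a')
      (S' y + act y' (star a)) (ip y x' + a * a') p"
    by (simp add: p link_op_apply blinfun.add_left blinfun.add_right theta_apply act_add_left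
        act_add_right act_act adjoint_pair_act[OF T] ip_add_left ip_add_right ip_act_left ip_act_right
        star_star algebra_simps)
qed

lemma adjoint_link_op:
  assumes "adjoint_pair T S"
  shows "adjoint_wrt (sum_ip ip) (sum_ip ip) (link_op act ip T x y a) = link_op act ip S y x (star a)"
proof (rule adjoint_wrt_eqI)
  fix w w' :: "'x \<times> 'a"
  assume eq: "sum_ip ip u w = sum_ip ip u w'" for u
  have "star (0::'a) = 0" using norm_star_eq[of 0] by simp
  then have "ip z (fst w) = ip z (fst w')" for z using eq[of "(z, 0)"] by (simp add: sum_ip_def)
  moreover have "star b * snd w = star b * snd w'" for b
    using eq[of "(0, b)"] by (simp add: sum_ip_def ip_zero)
  ultimately show "w = w'" by (auto intro: prod_eqI ip_nondegenerate star_mult_cancel)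
next
  fix u v :: "'x \<times> 'a"
  have "ip (T z) z' = ip z (S z')" for z z' using assms by (simp add: adjoint_pair_def)
  then show "sum_ip ip (link_op act ip T x y a u) v = sum_ip ip u (link_op act ip S y x (star a) v)"
    by (cases u, cases v) (simp add: sum_ip_def link_op_apply ip_add_left ip_add_right ip_act_left
        ip_act_right star_add star_mult ip_star algebra_simps)
qed

end

lemma compact_ops_mono: "Y \<subseteq> Z \<Longrightarrow> compact_ops act ip Y \<subseteq> compact_ops act ip Z"
  unfolding compact_ops_def closed_cspan_def
  by (intro closure_mono module.span_mono[OF module_scaleC]) blast

lemma link_set_mono:
  "\<K> \<subseteq> \<K>' \<Longrightarrow> link_set act ip \<K> Y D \<subseteq> link_set act ip \<K>' Y D"
  unfolding link_set_def by blast

section \<open>The dilation and the representation of the compact operators\<close>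

locale linked_stinespring = hilbert_module act ip
  for act :: "'x::{complex_normed_vector, complete_space} \<Rightarrow> 'a::cstar_algebra \<Rightarrow> 'x"
    and ip :: "'x \<Rightarrow> 'x \<Rightarrow> 'a" +
  fixes \<phi> :: "'a \<Rightarrow> ('h::chilbert_space \<Rightarrow>\<^sub>L 'h)"
    and \<Phi> :: "'x \<Rightarrow> ('h \<Rightarrow>\<^sub>L 'k::chilbert_space)"
    and \<pi> :: "'a \<Rightarrow> ('h1::chilbert_space \<Rightarrow>\<^sub>L 'h1)"
    and \<Psi> :: "'x \<Rightarrow> ('h1 \<Rightarrow>\<^sub>L 'k1::chilbert_space)"
    and V :: "'h \<Rightarrow>\<^sub>L 'h1" and W :: "'k \<Rightarrow>\<^sub>L 'k1"
    and \<sigma> :: "('x \<Rightarrow>\<^sub>L 'x) \<Rightarrow> ('k \<Rightarrow>\<^sub>L 'k)"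
  assumes minimal: "minimal_stinespring ip \<phi> \<Phi> \<pi> \<Psi> V W"
    and compact_rep: "compact_representation act ip \<Psi> W \<sigma>"
begin

lemma V_bdd [simp, intro]: "V \<in> bdd_ops" and W_bdd [simp, intro]: "W \<in> bdd_ops"
  and \<pi>_bdd [simp, intro]: "\<pi> a \<in> bdd_ops" and \<Psi>_bdd [simp, intro]: "\<Psi> x \<in> bdd_ops"
  and \<pi>_add: "\<pi> (a + b) = \<pi> a + \<pi> b" and \<pi>_mult: "\<pi> (a * b) = \<pi> a o\<^sub>L \<pi> b"
  and \<pi>_star: "\<pi> (star a) = adj (\<pi> a)"
  and \<Psi>_ip: "adj (\<Psi> x) o\<^sub>L \<Psi> y = \<pi> (ip x y)"
  and coisometry: "W o\<^sub>L adj W = id_blinfun"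
  and \<phi>_dilation: "\<phi> a = (adj V o\<^sub>L \<pi> a) o\<^sub>L V" and \<Phi>_dilation: "\<Phi> x = (adj W o\<^sub>L \<Psi> x) o\<^sub>L V"
  and total: "closed_cspan {\<pi> a (V h) | a h. True} = UNIV"
  using minimal unfolding minimal_stinespring_def star_representation_def phi_map_def by blast+

lemma \<phi>_bdd [simp, intro]: "\<phi> a \<in> bdd_ops" and \<Phi>_bdd [simp, intro]: "\<Phi> x \<in> bdd_ops"
  by (simp_all add: \<phi>_dilation \<Phi>_dilation)

lemma \<sigma>_bdd [simp, intro]: "T \<in> K \<Longrightarrow> \<sigma> T \<in> bdd_ops"
  and \<sigma>_add: "S \<in> K \<Longrightarrow> T \<in> K \<Longrightarrow> \<sigma> (S + T) = \<sigma> S + \<sigma> T"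
  and \<sigma>_compose: "S \<in> K \<Longrightarrow> T \<in> K \<Longrightarrow> \<sigma> (S o\<^sub>L T) = \<sigma> S o\<^sub>L \<sigma> T"
  and \<sigma>_theta: "\<sigma> (theta act ip x y) = ((adj W o\<^sub>L \<Psi> x) o\<^sub>L adj (\<Psi> y)) o\<^sub>L W"
  using compact_rep unfolding compact_representation_def star_representation_def by blast+

lemma \<sigma>_adjoint: "T \<in> K \<Longrightarrow> adjoint_pair T S \<Longrightarrow> \<sigma> S = adj (\<sigma> T)"
  using compact_rep adjoint_wrt_adjoint_pair
  unfolding compact_representation_def star_representation_def by metis

lemma coisometry_cancel: "W o\<^sub>L (adj W o\<^sub>L F) = F"
  by (simp add: coisometry flip: compose_assoc)

lemma adj_W_cancel: "adj W o\<^sub>L F = adj W o\<^sub>L G \<longleftrightarrow> F = G"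
  by (metis coisometry_cancel)

lemma \<phi>_add: "\<phi> (a + b) = \<phi> a + \<phi> b"
  by (simp add: \<phi>_dilation \<pi>_add compose_add_left compose_add_right)

lemma \<phi>_star: "\<phi> (star a) = adj (\<phi> a)"
  by (simp add: \<phi>_dilation \<pi>_star adj_compose compose_assoc)

lemma \<Psi>_act: "\<Psi> (act x a) = \<Psi> x o\<^sub>L \<pi> a"
proof -
  have "\<Psi> (act x a) - (\<Psi> x o\<^sub>L \<pi> a) = 0"
  proof (rule eq_zero_if_adj_compose_zero)
    have "adj (\<Psi> x o\<^sub>L \<pi> a) = \<pi> (star a) o\<^sub>L adj (\<Psi> x)" by (simp add: adj_compose \<pi>_star)
    moreover have "adj (\<Psi> x) o\<^sub>L (\<Psi> y o\<^sub>L F) = \<pi> (ip x y) o\<^sub>L F" for x y and F :: "'h1 \<Rightarrow>\<^sub>L 'h1"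
      by (simp add: \<Psi>_ip flip: compose_assoc)
    ultimately show "adj (\<Psi> (act x a) - (\<Psi> x o\<^sub>L \<pi> a)) o\<^sub>L (\<Psi> (act x a) - (\<Psi> x o\<^sub>L \<pi> a)) = 0"
      by (simp add: adj_diff compose_diff_left compose_diff_right compose_assoc \<Psi>_ip ip_act_left
        ip_act_right \<pi>_mult)
  qed simp
  then show ?thesis by simp
qed

lemma \<Psi>_add: "\<Psi> (x + y) = \<Psi> x + \<Psi> y"
proof -
  have "\<Psi> (x + y) - \<Psi> x - \<Psi> y = 0"
    by (rule eq_zero_if_adj_compose_zero)
      (simp_all add: adj_diff compose_diff_left compose_diff_right \<Psi>_ip ip_add_left ip_add_right \<pi>_add)
  then show ?thesis by (simp add: algebra_simps)
qed

lemma \<Phi>_add: "\<Phi> (x + y) = \<Phi> x + \<Phi> y"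
  by (simp add: \<Phi>_dilation \<Psi>_add compose_add_left compose_add_right)

lemma adj_\<Phi>_compose_\<Phi>: "adj (\<Phi> x) o\<^sub>L \<Phi> y = \<phi> (ip x y)"
proof -
  have "adj (\<Phi> x) o\<^sub>L \<Phi> y = adj V o\<^sub>L ((adj (\<Psi> x) o\<^sub>L (W o\<^sub>L (adj W o\<^sub>L \<Psi> y))) o\<^sub>L V)"
    by (simp add: \<Phi>_dilation adj_compose compose_assoc)
  then show ?thesis by (simp add: coisometry_cancel \<Psi>_ip \<phi>_dilation compose_assoc)
qed

text \<open>The key relation. It amounts to saying that \<open>W \<sigma>(T) W\<^sup>*\<close> sends \<open>\<Psi>(x) \<xi>\<close> to \<open>\<Psi>(T x) \<xi>\<close> and that \<open>\<sigma>(T)\<close>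
  leaves the initial space of \<open>W\<close> invariant.\<close>

lemma \<sigma>_intertwines_\<Psi>:
  assumes T: "T \<in> K"
  shows "\<sigma> T o\<^sub>L (adj W o\<^sub>L \<Psi> x) = adj W o\<^sub>L \<Psi> (T x)"
proof -
  obtain S where S: "adjoint_pair T S" using compact_adjoint T by blast
  define E where "E = (\<sigma> T o\<^sub>L (adj W o\<^sub>L \<Psi> x)) - (adj W o\<^sub>L \<Psi> (T x))"
  have E_bdd: "E \<in> bdd_ops" using T by (simp add: E_def)
  have E0: "E o\<^sub>L adj (\<Psi> v) = 0" for v
  proof -
    have "\<sigma> T o\<^sub>L \<sigma> (theta act ip x v) = \<sigma> (theta act ip (T x) v)"
      by (simp add: \<sigma>_compose[symmetric] T compose_theta[OF S])
    then have "((E o\<^sub>L adj (\<Psi> v)) o\<^sub>L W) o\<^sub>L adj W = 0"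
      by (simp add: \<sigma>_theta E_def compose_diff_left compose_assoc)
    then show ?thesis by (simp add: compose_assoc coisometry)
  qed
  \<comment> \<open>both terms of \<open>E\<^sup>*\<close> begin with the adjoint of a value of \<open>\<Psi>\<close>, which \<open>E\<close> annihilates\<close>
  have "E o\<^sub>L adj E = 0"
  proof -
    have "adj E = (adj (\<Psi> x) o\<^sub>L (W o\<^sub>L adj (\<sigma> T))) - (adj (\<Psi> (T x)) o\<^sub>L W)"
      using T by (simp add: E_def adj_diff adj_compose compose_assoc)
    then show ?thesis by (simp add: compose_diff_right E0 flip: compose_assoc)
  qed
  then have "adj E = 0"
    using eq_zero_if_adj_compose_zero[of "adj E"] E_bdd by simp
  then have "E = 0" using E_bdd
    by (metis adj_adj adj_diff adj_in_bdd_ops diff_self)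
  then show ?thesis by (simp add: E_def)
qed

lemma \<sigma>_intertwines_\<Phi>: "T \<in> K \<Longrightarrow> \<sigma> T o\<^sub>L \<Phi> x = \<Phi> (T x)"
  using \<sigma>_intertwines_\<Psi>[of T x] by (simp add: \<Phi>_dilation flip: compose_assoc)

section \<open>Multiplicative and ternary domains in terms of the dilation\<close>

abbreviation P :: "'h1 \<Rightarrow>\<^sub>L 'h1" where "P \<equiv> V o\<^sub>L adj V"

lemma adj_P: "adj P = P"
  by (simp add: adj_compose)

abbreviation X\<phi> where "X\<phi> \<equiv> module_ternary_domain act \<phi> \<Phi>"
abbreviation M\<phi> where "M\<phi> \<equiv> mult_domain UNIV (*) \<phi>"
abbreviation T\<phi> where "T\<phi> \<equiv> ternary_domain UNIV (*) star \<phi>"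

lemma eq_if_eq_on_\<pi>_V:
  assumes "F \<in> bdd_ops" "G \<in> bdd_ops" and "\<And>b. F o\<^sub>L (\<pi> b o\<^sub>L V) = G o\<^sub>L (\<pi> b o\<^sub>L V)"
  shows "F = G"
proof (rule bdd_ops_eqI_total[OF assms(1,2) total])
  fix s assume "s \<in> {\<pi> a (V h) |a h. True}"
  then obtain b h where "s = \<pi> b (V h)" by blast
  then show "F s = G s" using arg_cong[OF assms(3)[of b], of "\<lambda>F. F h"] by simp
qed

text \<open>Both sides of \<open>\<Phi>(x b) = \<Phi>(x) \<phi>(b)\<close> have the form \<open>W\<^sup>* F \<pi>(b) V\<close>, with \<open>F = \<Psi>(x)\<close> and \<open>F = \<Psi>(x) P\<close>;
  \<open>W\<^sup>*\<close> is injective.\<close>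

lemma X\<phi>_absorbs_P: 
  assumes "x \<in> X\<phi>"
  shows "\<Psi> x o\<^sub>L P = \<Psi> x"
proof (rule eq_if_eq_on_\<pi>_V)
  fix b
  have "\<Phi> x o\<^sub>L \<phi> b = \<Phi> (act x b)" using assms by (simp add: module_ternary_domain_def)
  then show "(\<Psi> x o\<^sub>L P) o\<^sub>L (\<pi> b o\<^sub>L V) = \<Psi> x o\<^sub>L (\<pi> b o\<^sub>L V)"
    by (simp add: \<Phi>_dilation \<phi>_dilation \<Psi>_act compose_assoc adj_W_cancel)
qed auto

lemma X\<phi>_absorbs_P_adj: 
  assumes "x \<in> X\<phi>"
  shows "P o\<^sub>L adj (\<Psi> x) = adj (\<Psi> x)"
  using arg_cong[OF X\<phi>_absorbs_P[OF assms], of adj] by (simp add: adj_compose[of "\<Psi> x" P] adj_P)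

text \<open>Multiplicativity against \<open>b\<^sup>*\<close> says that \<open>G = \<pi>(a) V\<close> and \<open>P G\<close> have the same inner products with all
  vectors \<open>\<pi>(b) V h\<close>.\<close>

lemma M\<phi>_preserves_V:
  assumes "a \<in> M\<phi>"
  shows "P o\<^sub>L (\<pi> a o\<^sub>L V) = \<pi> a o\<^sub>L V"
proof -
  define G where "G = \<pi> a o\<^sub>L V"
  have G: "G \<in> bdd_ops" by (simp add: G_def)
  have "adj (P o\<^sub>L G) = adj G"
  proof (rule eq_if_eq_on_\<pi>_V)
    fix b
    have "\<phi> (star b) o\<^sub>L \<phi> a = \<phi> (star b * a)" using assms by (simp add: mult_domain_def)
    then have "adj V o\<^sub>L (\<pi> (star b) o\<^sub>L (P o\<^sub>L G)) = adj V o\<^sub>L (\<pi> (star b) o\<^sub>L G)"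
      by (simp add: \<phi>_dilation \<pi>_mult compose_assoc G_def)
    from arg_cong[OF this, of adj]
    show "adj (P o\<^sub>L G) o\<^sub>L (\<pi> b o\<^sub>L V) = adj G o\<^sub>L (\<pi> b o\<^sub>L V)"
      using G by (simp add: adj_compose[of "adj V"] adj_compose[of "adj (\<pi> b)"] \<pi>_star compose_assoc)
  qed (use G in auto)
  then have "P o\<^sub>L G = G" using G by (metis adj_adj compose_in_bdd_ops adj_in_bdd_ops V_bdd)
  then show ?thesis by (simp add: G_def)
qed

lemma M\<phi>_star: "a \<in> M\<phi> \<Longrightarrow> star a \<in> M\<phi>"
proof -
  assume a: "a \<in> M\<phi>"
  have "\<phi> (star a * b) = \<phi> (star a) o\<^sub>L \<phi> b \<and> \<phi> (b * star a) = \<phi> b o\<^sub>L \<phi> (star a)" for b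
  proof -
    have "\<phi> (star b * a) = \<phi> (star b) o\<^sub>L \<phi> a" "\<phi> (a * star b) = \<phi> a o\<^sub>L \<phi> (star b)"
      using a by (simp_all add: mult_domain_def)
    then have "adj (\<phi> (star b * a)) = adj (\<phi> (star b) o\<^sub>L \<phi> a)"
      "adj (\<phi> (a * star b)) = adj (\<phi> a o\<^sub>L \<phi> (star b))" by simp_all
    then show ?thesis by (simp add: adj_compose star_mult star_star flip: \<phi>_star)
  qed
  then show ?thesis by (simp add: mult_domain_def)
qed

lemma \<Phi>_act_M\<phi>: "a \<in> M\<phi> \<Longrightarrow> \<Phi> (act y a) = \<Phi> y o\<^sub>L \<phi> a"
  using M\<phi>_preserves_V[of a] by (simp add: \<Phi>_dilation \<phi>_dilation \<Psi>_act compose_assoc)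

text \<open>The two sides differ only by a factor \<open>P\<close> between \<open>\<Psi>(x)\<close> and \<open>\<Psi>(y)\<^sup>*\<close>, and a vector in \<open>X\<phi>\<close> on either
  side absorbs it.\<close>

lemma \<sigma>_theta_X\<phi>:
  assumes "x \<in> X\<phi> \<or> y \<in> X\<phi>"
  shows "\<sigma> (theta act ip x y) = \<Phi> x o\<^sub>L adj (\<Phi> y)"
proof -
  have "\<Psi> x o\<^sub>L (P o\<^sub>L adj (\<Psi> y)) = \<Psi> x o\<^sub>L adj (\<Psi> y)"
    using assms X\<phi>_absorbs_P[of x] X\<phi>_absorbs_P_adj[of y] by (metis compose_assoc)
  then have "adj W o\<^sub>L ((\<Psi> x o\<^sub>L (P o\<^sub>L adj (\<Psi> y))) o\<^sub>L W) = adj W o\<^sub>L ((\<Psi> x o\<^sub>L adj (\<Psi> y)) o\<^sub>L W)"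
    by simp
  then show ?thesis by (simp add: \<sigma>_theta \<Phi>_dilation adj_compose compose_assoc)
qed

lemma X\<phi>_compact:
  assumes "T \<in> K" "x \<in> X\<phi>"
  shows "T x \<in> X\<phi>"
proof -
  obtain S where S: "adjoint_pair T S" using compact_adjoint assms(1) by blast
  have "\<Phi> (act (T x) b) = \<Phi> (T x) o\<^sub>L \<phi> b" for b
  proof -
    have "\<Phi> (act (T x) b) = \<sigma> T o\<^sub>L \<Phi> (act x b)"
      using assms(1) by (simp add: \<sigma>_intertwines_\<Phi> adjoint_pair_act[OF S])
    also have "\<dots> = (\<sigma> T o\<^sub>L \<Phi> x) o\<^sub>L \<phi> b"
      using assms(2) by (simp add: module_ternary_domain_def compose_assoc)
    finally show ?thesis using assms(1) by (simp add: \<sigma>_intertwines_\<Phi>)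
  qed
  then show ?thesis by (simp add: module_ternary_domain_def)
qed

lemma X\<phi>_add: "x \<in> X\<phi> \<Longrightarrow> y \<in> X\<phi> \<Longrightarrow> x + y \<in> X\<phi>"
  by (simp add: module_ternary_domain_def act_add_left \<Phi>_add compose_add_left)

text \<open>Removing \<open>c\<close> and then \<open>b\<close> from the ternary identity by density gives \<open>\<pi>(a) = P \<pi>(a) P\<close>, and
  \<open>P \<pi>(a) P = \<pi>(a) P\<close> because \<open>a\<close> is in the multiplicative domain. The identity is used for \<open>b\<^sup>*\<close> so that
  the adjoint of the intermediate result is again about vectors \<open>\<pi>(b) V h\<close>.\<close>

lemma T\<phi>_absorbs_P:
  assumes "a \<in> T\<phi>"
  shows "\<pi> a o\<^sub>L P = \<pi> a"
proof -
  have a: "a \<in> M\<phi>" using assms by (simp add: ternary_domain_def)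
  have "\<pi> a = P o\<^sub>L (\<pi> a o\<^sub>L P)"
  proof (rule eq_if_eq_on_\<pi>_V)
    fix b
    have "adj V o\<^sub>L (\<pi> (star b) o\<^sub>L \<pi> (star a)) = adj V o\<^sub>L (\<pi> (star b) o\<^sub>L (P o\<^sub>L (\<pi> (star a) o\<^sub>L P)))"
    proof (rule eq_if_eq_on_\<pi>_V)
      fix c
      have "\<phi> (star b * star a * c) = (\<phi> (star b) o\<^sub>L \<phi> (star a)) o\<^sub>L \<phi> c"
        using assms by (simp add: ternary_domain_def \<phi>_star)
      then show "(adj V o\<^sub>L (\<pi> (star b) o\<^sub>L \<pi> (star a))) o\<^sub>L (\<pi> c o\<^sub>L V) =
        (adj V o\<^sub>L (\<pi> (star b) o\<^sub>L (P o\<^sub>L (\<pi> (star a) o\<^sub>L P)))) o\<^sub>L (\<pi> c o\<^sub>L V)"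
        by (simp add: \<phi>_dilation \<pi>_mult compose_assoc)
    qed auto
    from arg_cong[OF this, of adj]
    show "\<pi> a o\<^sub>L (\<pi> b o\<^sub>L V) = (P o\<^sub>L (\<pi> a o\<^sub>L P)) o\<^sub>L (\<pi> b o\<^sub>L V)"
      by (simp add: adj_compose \<pi>_star compose_assoc)
  qed auto
  moreover have "P o\<^sub>L (\<pi> a o\<^sub>L P) = \<pi> a o\<^sub>L P"
    using M\<phi>_preserves_V[OF a] by (metis compose_assoc)
  ultimately show ?thesis by simp
qed

lemma T\<phi>_star:
  assumes "a \<in> T\<phi>"
  shows "star a \<in> T\<phi>"
proof -
  have "\<phi> (b * a * c) = (\<phi> b o\<^sub>L \<phi> a) o\<^sub>L \<phi> c" for b c
  proof -
    have "adj (\<phi> (star c * star a * star b)) = adj ((\<phi> (star c) o\<^sub>L adj (\<phi> a)) o\<^sub>L \<phi> (star b))"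
      using assms by (simp add: ternary_domain_def)
    moreover have "adj (\<phi> (star c * star a * star b)) = \<phi> (b * a * c)"
      by (simp add: star_mult star_star mult.assoc flip: \<phi>_star)
    moreover have "adj ((\<phi> (star c) o\<^sub>L adj (\<phi> a)) o\<^sub>L \<phi> (star b)) = (\<phi> b o\<^sub>L \<phi> a) o\<^sub>L \<phi> c"
      by (simp add: adj_compose compose_assoc \<phi>_star)
    ultimately show ?thesis by simp
  qed
  then show ?thesis
    using assms M\<phi>_star[of a] by (simp add: ternary_domain_def \<phi>_star star_star)
qed

lemma X\<phi>_act_T\<phi>:
  assumes "a \<in> T\<phi>"
  shows "act v a \<in> X\<phi>"
proof -
  have "\<Phi> (act (act v a) b) = \<Phi> (act v a) o\<^sub>L \<phi> b" for b
  proof -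
    have "\<Phi> (act v a) o\<^sub>L \<phi> b = adj W o\<^sub>L (\<Psi> v o\<^sub>L ((\<pi> a o\<^sub>L P) o\<^sub>L (\<pi> b o\<^sub>L V)))"
      by (simp add: \<Phi>_dilation \<phi>_dilation \<Psi>_act compose_assoc)
    then show ?thesis
      unfolding T\<phi>_absorbs_P[OF assms] by (simp add: \<Phi>_dilation \<Psi>_act compose_assoc)
  qed
  then show ?thesis by (simp add: module_ternary_domain_def)
qed

text \<open>Elements \<open>\<langle>x, y\<rangle>\<close> with \<open>x\<close> in \<open>X\<phi>\<close> behave well as right factors, since \<open>\<pi>(\<langle>x, y\<rangle>) = \<Psi>(x)\<^sup>* \<Psi>(y)\<close>
  absorbs \<open>P\<close> from the left.\<close>

lemma X\<phi>_ip:
  assumes "x \<in> X\<phi>"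
  shows "\<Phi> (act u (ip x y)) = \<Phi> u o\<^sub>L \<phi> (ip x y)" "\<phi> (b * ip x y) = \<phi> b o\<^sub>L \<phi> (ip x y)"
proof -
  have *: "V o\<^sub>L (adj V o\<^sub>L (\<pi> (ip x y) o\<^sub>L V)) = \<pi> (ip x y) o\<^sub>L V"
    using X\<phi>_absorbs_P_adj[OF assms] by (metis \<Psi>_ip compose_assoc)
  show "\<Phi> (act u (ip x y)) = \<Phi> u o\<^sub>L \<phi> (ip x y)" "\<phi> (b * ip x y) = \<phi> b o\<^sub>L \<phi> (ip x y)"
    by (simp_all add: \<Phi>_dilation \<phi>_dilation \<Psi>_act \<pi>_mult compose_assoc *)
qed

section \<open>The domains of the linking map\<close>

abbreviation lk where "lk \<equiv> link_op act ip"
abbreviation L where "L \<equiv> linking_algebra act ip"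
abbreviation \<phi>t where "\<phi>t \<equiv> linking_map act ip \<sigma> \<Phi> \<phi>"
abbreviation lstar where "lstar \<equiv> adjoint_wrt (sum_ip ip) (sum_ip ip)"

text \<open>In each matrix entry one summand of \<open>\<phi>t (U U')\<close> agrees with one of \<open>\<phi>t U \<phi>t U'\<close>, by multiplicativity
  of \<open>\<sigma>\<close>, by the intertwining relation (for the lower left entry after taking adjoints), or because \<open>\<Phi>\<close> is a
  \<open>\<phi>\<close>-map. Cancelling it leaves the four equations.\<close>

lemma linking_map_mult_iff:
  assumes T: "T \<in> K" and T': "T' \<in> K"
  shows "\<phi>t (lk T x y a o\<^sub>L lk T' x' y' a') = \<phi>t (lk T x y a) o\<^sub>L \<phi>t (lk T' x' y' a') \<longleftrightarrow>
    \<sigma> (theta act ip x y') = \<Phi> x o\<^sub>L adj (\<Phi> y') \<and>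
    \<Phi> (act x a') = \<Phi> x o\<^sub>L \<phi> a' \<and>
    \<Phi> (act y' (star a)) = \<Phi> y' o\<^sub>L \<phi> (star a) \<and>
    \<phi> (a * a') = \<phi> a o\<^sub>L \<phi> a'"
proof -
  obtain S where S: "adjoint_pair T S" using compact_adjoint T by blast
  obtain S' where S'K: "S' \<in> K" and S': "adjoint_pair T' S'" using compact_adjoint T' by blast
  have "adj (\<Phi> (S' y)) = adj (\<Phi> y) o\<^sub>L \<sigma> T'"
    unfolding \<sigma>_intertwines_\<Phi>[OF S'K, symmetric] by (simp add: \<sigma>_adjoint[OF T' S'] adj_compose T')
  moreover have "adj (\<Phi> (act y' (star a))) = \<phi> a o\<^sub>L adj (\<Phi> y') \<longleftrightarrow>
      \<Phi> (act y' (star a)) = \<Phi> y' o\<^sub>L \<phi> (star a)"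
    using adj_inject[of "\<Phi> (act y' (star a))" "\<Phi> y' o\<^sub>L \<phi> (star a)"]
    by (simp add: adj_compose \<phi>_star)
  ultimately show ?thesis
    using T T'
    by (simp add: link_op_compose[OF S S'] linking_map_link_op block_op_compose block_op_inject
        \<sigma>_add \<sigma>_compose \<Phi>_add \<sigma>_intertwines_\<Phi> adj_add \<phi>_add adj_\<Phi>_compose_\<Phi>)
qed

text \<open>Necessity needs only products with the corner \<open>A\<close> of the linking algebra: products from the right give the
  condition on \<open>x\<close>, those from the left the condition on \<open>y\<close>.\<close>

lemma in_mult_domain_linking_iff:
  assumes T: "T \<in> K"
  shows "lk T x y a \<in> mult_domain L (o\<^sub>L) \<phi>t \<longleftrightarrow> x \<in> X\<phi> \<and> y \<in> X\<phi> \<and> a \<in> M\<phi>"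
proof
  assume U: "lk T x y a \<in> mult_domain L (o\<^sub>L) \<phi>t"
  have B: "lk 0 0 0 b \<in> L" for b by (auto simp: link_set_def)
  have right: "\<phi>t (lk T x y a o\<^sub>L lk 0 0 0 b) = \<phi>t (lk T x y a) o\<^sub>L \<phi>t (lk 0 0 0 b)"
    and left: "\<phi>t (lk 0 0 0 b o\<^sub>L lk T x y a) = \<phi>t (lk 0 0 0 b) o\<^sub>L \<phi>t (lk T x y a)" for b
    using U B by (simp_all add: mult_domain_def)
  have x: "\<Phi> (act x b) = \<Phi> x o\<^sub>L \<phi> b" "\<phi> (a * b) = \<phi> a o\<^sub>L \<phi> b"
    and y: "\<Phi> (act y (star b)) = \<Phi> y o\<^sub>L \<phi> (star b)" "\<phi> (b * a) = \<phi> b o\<^sub>L \<phi> a" for b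
    using right[of b] left[of b] T by (simp_all add: linking_map_mult_iff)
  have "\<Phi> (act y b) = \<Phi> y o\<^sub>L \<phi> b" for b using y(1)[of "star b"] by (simp add: star_star)
  with x y(2) show "x \<in> X\<phi> \<and> y \<in> X\<phi> \<and> a \<in> M\<phi>"
    by (simp add: module_ternary_domain_def mult_domain_def)
next
  assume *: "x \<in> X\<phi> \<and> y \<in> X\<phi> \<and> a \<in> M\<phi>"
  then have xy: "\<Phi> (act x b) = \<Phi> x o\<^sub>L \<phi> b" "\<Phi> (act y b) = \<Phi> y o\<^sub>L \<phi> b"
    and a: "\<phi> (a * b) = \<phi> a o\<^sub>L \<phi> b" "\<phi> (b * a) = \<phi> b o\<^sub>L \<phi> a" for b
    by (simp_all add: module_ternary_domain_def mult_domain_def)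
  have "\<phi>t (lk T x y a o\<^sub>L U') = \<phi>t (lk T x y a) o\<^sub>L \<phi>t U' \<and>
      \<phi>t (U' o\<^sub>L lk T x y a) = \<phi>t U' o\<^sub>L \<phi>t (lk T x y a)" if "U' \<in> L" for U'
  proof -
    obtain T' x' y' a' where "T' \<in> K" "U' = lk T' x' y' a'"
      using \<open>U' \<in> L\<close> by (auto simp: link_set_def)
    then show ?thesis
      using * T by (simp add: linking_map_mult_iff xy a \<sigma>_theta_X\<phi> \<Phi>_act_M\<phi> M\<phi>_star)
  qed
  moreover have "lk T x y a \<in> L" using T by (auto simp: link_set_def)
  ultimately show "lk T x y a \<in> mult_domain L (o\<^sub>L) \<phi>t" by (simp add: mult_domain_def)
qed

lemma mult_domain_linking:
  "mult_domain L (o\<^sub>L) \<phi>t = link_set act ip K X\<phi> M\<phi>"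
proof (intro equalityI subsetI)
  fix U assume U: "U \<in> mult_domain L (o\<^sub>L) \<phi>t"
  then obtain T x y a where T: "T \<in> K" and eq: "U = lk T x y a"
    by (auto simp: mult_domain_def link_set_def)
  have "x \<in> X\<phi> \<and> y \<in> X\<phi> \<and> a \<in> M\<phi>"
    using U unfolding eq in_mult_domain_linking_iff[OF T] .
  then show "U \<in> link_set act ip K X\<phi> M\<phi>"
    using T eq by (auto simp: link_set_def)
next
  fix U assume "U \<in> link_set act ip K X\<phi> M\<phi>"
  then obtain T x y a where "T \<in> K" "U = lk T x y a" "x \<in> X\<phi>" "y \<in> X\<phi>" "a \<in> M\<phi>"
    unfolding link_set_def by blast
  then show "U \<in> mult_domain L (o\<^sub>L) \<phi>t"
    using in_mult_domain_linking_iff by blast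
qed

text \<open>For \<open>U\<close> in the multiplicative domain, membership means that \<open>\<phi>t\<close> is multiplicative on all products
  \<open>B D\<close> with \<open>D = U\<^sup>* C\<close>. Necessity again needs only \<open>B\<close> and \<open>C\<close> in the corner \<open>A\<close>. For sufficiency, the lower left
  entry of \<open>D\<close> is given by the vector \<open>Q\<^sup>* x + v' a\<close>, which lies in \<open>X\<phi>\<close>, and its lower right entry is
  \<open>\<langle>x, u'\<rangle> + a\<^sup>* c\<close>, whose summands are good right factors by \<open>x \<in> X\<phi>\<close> and \<open>a \<in> T\<phi>\<close> respectively.\<close>

lemma in_ternary_domain_linking_iff:
  assumes T: "T \<in> K"
  shows "lk T x y a \<in> ternary_domain L (o\<^sub>L) lstar \<phi>t \<longleftrightarrow> x \<in> X\<phi> \<and> y \<in> X\<phi> \<and> a \<in> T\<phi>"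
proof (cases "x \<in> X\<phi> \<and> y \<in> X\<phi> \<and> a \<in> M\<phi>")
  case False
  then show ?thesis
    using T by (auto simp: ternary_domain_def[of L] ternary_domain_def[of UNIV] in_mult_domain_linking_iff)
next
  case True
  then have x: "x \<in> X\<phi>" and y: "y \<in> X\<phi>" and a: "a \<in> M\<phi>" by auto
  obtain S where SK: "S \<in> K" and S: "adjoint_pair T S" using compact_adjoint T by blast
  have star: "lstar (lk T x y a) = lk S y x (star a)" by (rule adjoint_link_op[OF S])
  have U: "lk T x y a \<in> mult_domain L (o\<^sub>L) \<phi>t" using T True by (simp add: in_mult_domain_linking_iff)
  have "lk S y x (star a) \<in> mult_domain L (o\<^sub>L) \<phi>t"
    using SK x y M\<phi>_star[OF a] by (simp add: in_mult_domain_linking_iff)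
  then have starC: "\<phi>t (lk S y x (star a) o\<^sub>L C) = \<phi>t (lk S y x (star a)) o\<^sub>L \<phi>t C" if "C \<in> L" for C
    using that by (simp add: mult_domain_def)
  have adj: "adj (\<phi>t (lk T x y a)) = \<phi>t (lk S y x (star a))"
    using T SK by (simp add: linking_map_link_op adj_block_op \<sigma>_adjoint[OF T S] \<phi>_star)
  have "lk T x y a \<in> ternary_domain L (o\<^sub>L) lstar \<phi>t \<longleftrightarrow>
      (\<forall>B\<in>L. \<forall>C\<in>L. \<phi>t (B o\<^sub>L (lk S y x (star a) o\<^sub>L C)) = \<phi>t B o\<^sub>L \<phi>t (lk S y x (star a) o\<^sub>L C))"
    unfolding ternary_domain_def using U by (simp add: star adj starC compose_assoc)
  also have "\<dots> \<longleftrightarrow> a \<in> T\<phi>"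
  proof
    assume *: "\<forall>B\<in>L. \<forall>C\<in>L. \<phi>t (B o\<^sub>L (lk S y x (star a) o\<^sub>L C)) = \<phi>t B o\<^sub>L \<phi>t (lk S y x (star a) o\<^sub>L C)"
    have "\<phi> (b * star a * c) = (\<phi> b o\<^sub>L adj (\<phi> a)) o\<^sub>L \<phi> c" for b c
    proof -
      have "adjoint_pair 0 0" by (simp add: adjoint_pair_def ip_zero)
      then have "lk S y x (star a) o\<^sub>L lk 0 0 0 c =
          lk ((S o\<^sub>L 0) + theta act ip y 0) (S 0 + act y c) (blinfun_apply 0 x + act 0 a) (star a * c)"
        using link_op_compose[OF adjoint_pair_sym[OF S], of 0 0 y x "star a" 0 0 c]
        by (simp add: ip_zero star_star)
      moreover have "(S o\<^sub>L 0) + theta act ip y 0 \<in> K" using SK by blast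
      moreover have "lk 0 0 0 b \<in> L" "lk 0 0 0 c \<in> L" by (auto simp: link_set_def)
      ultimately have "\<phi> (b * (star a * c)) = \<phi> b o\<^sub>L \<phi> (star a * c)"
        using * by (metis linking_map_mult_iff zero_in_compact)
      moreover have "\<phi> (star a * c) = adj (\<phi> a) o\<^sub>L \<phi> c"
        using M\<phi>_star[OF a] by (simp add: mult_domain_def \<phi>_star)
      ultimately show ?thesis by (simp add: mult.assoc compose_assoc)
    qed
    then show "a \<in> T\<phi>" using a by (simp add: ternary_domain_def)
  next
    assume aT: "a \<in> T\<phi>"
    have "\<phi>t (B o\<^sub>L (lk S y x (star a) o\<^sub>L C)) = \<phi>t B o\<^sub>L \<phi>t (lk S y x (star a) o\<^sub>L C)"
      if "B \<in> L" "C \<in> L" for B C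
    proof -
      obtain R u v b where R: "R \<in> K" and B: "B = lk R u v b"
        using \<open>B \<in> L\<close> by (auto simp: link_set_def)
      obtain Q u' v' c where Q: "Q \<in> K" and C: "C = lk Q u' v' c"
        using \<open>C \<in> L\<close> by (auto simp: link_set_def)
      obtain Q' where Q'K: "Q' \<in> K" and Q': "adjoint_pair Q Q'" using compact_adjoint Q by blast
      define y'' where "y'' = Q' x + act v' a"
      have D: "lk S y x (star a) o\<^sub>L C =
          lk ((S o\<^sub>L Q) + theta act ip y v') (S u' + act y c) y'' (ip x u' + star a * c)"
        unfolding C y''_def
        using link_op_compose[OF adjoint_pair_sym[OF S] Q', of y x "star a" u' v' c]
        by (simp add: star_star)
      have DK: "(S o\<^sub>L Q) + theta act ip y v' \<in> K" using SK Q by blast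
      have y'': "y'' \<in> X\<phi>"
        unfolding y''_def using Q'K x aT by (intro X\<phi>_add X\<phi>_compact X\<phi>_act_T\<phi>)
      have sa: "\<phi> (star a * c) = \<phi> (star a) o\<^sub>L \<phi> c"
        using M\<phi>_star[OF a] by (simp add: mult_domain_def)
      have "\<Phi> (act u (star a * c)) = \<Phi> u o\<^sub>L \<phi> (star a * c)"
      proof -
        have "\<Phi> (act (act u (star a)) c) = \<Phi> (act u (star a)) o\<^sub>L \<phi> c"
          using X\<phi>_act_T\<phi>[OF T\<phi>_star[OF aT], of u] by (simp add: module_ternary_domain_def)
        then show ?thesis
          by (simp add: act_act sa \<Phi>_act_M\<phi> M\<phi>_star[OF a] compose_assoc)
      qed
      moreover have "\<phi> (b * (star a * c)) = \<phi> b o\<^sub>L \<phi> (star a * c)"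
        using aT sa by (simp add: ternary_domain_def \<phi>_star compose_assoc flip: mult.assoc)
      ultimately show ?thesis
        using y'' unfolding D B linking_map_mult_iff[OF R DK]
        by (simp add: \<sigma>_theta_X\<phi> X\<phi>_ip[OF x] act_add_right \<Phi>_add \<phi>_add compose_add_right
            distrib_left) (simp add: module_ternary_domain_def)
    qed
    then show "\<forall>B\<in>L. \<forall>C\<in>L. \<phi>t (B o\<^sub>L (lk S y x (star a) o\<^sub>L C)) = \<phi>t B o\<^sub>L \<phi>t (lk S y x (star a) o\<^sub>L C)"
      by blast
  qed
  finally show ?thesis using x y by simp
qed

lemma ternary_domain_linking:
  "ternary_domain L (o\<^sub>L) lstar \<phi>t = link_set act ip K X\<phi> T\<phi>"
proof (intro equalityI subsetI)
  fix U assume U: "U \<in> ternary_domain L (o\<^sub>L) lstar \<phi>t"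
  then obtain T x y a where T: "T \<in> K" and eq: "U = lk T x y a"
    by (auto simp: ternary_domain_def mult_domain_def link_set_def)
  have "x \<in> X\<phi> \<and> y \<in> X\<phi> \<and> a \<in> T\<phi>"
    using U unfolding eq in_ternary_domain_linking_iff[OF T] .
  then show "U \<in> link_set act ip K X\<phi> T\<phi>"
    using T eq by (auto simp: link_set_def)
next
  fix U assume "U \<in> link_set act ip K X\<phi> T\<phi>"
  then obtain T x y a where "T \<in> K" "U = lk T x y a" "x \<in> X\<phi>" "y \<in> X\<phi>" "a \<in> T\<phi>"
    unfolding link_set_def by blast
  then show "U \<in> ternary_domain L (o\<^sub>L) lstar \<phi>t"
    using in_ternary_domain_linking_iff by blast
qed

end

theorem theorem5p7:
  fixes act :: "'x::{complex_normed_vector, complete_space} \<Rightarrow> 'a::cstar_algebra \<Rightarrow> 'x"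
    and ip :: "'x \<Rightarrow> 'x \<Rightarrow> 'a"
    and \<phi> :: "'a \<Rightarrow> ('h::chilbert_space \<Rightarrow>\<^sub>L 'h)"
    and \<Phi> :: "'x \<Rightarrow> ('h \<Rightarrow>\<^sub>L 'k::chilbert_space)"
    and \<pi> :: "'a \<Rightarrow> ('h1::chilbert_space \<Rightarrow>\<^sub>L 'h1)"
    and \<Psi> :: "'x \<Rightarrow> ('h1 \<Rightarrow>\<^sub>L 'k1::chilbert_space)"
    and V :: "'h \<Rightarrow>\<^sub>L 'h1" and W :: "'k \<Rightarrow>\<^sub>L 'k1"
    and \<sigma> :: "('x \<Rightarrow>\<^sub>L 'x) \<Rightarrow> ('k \<Rightarrow>\<^sub>L 'k)"
  assumes "hilbert_module act ip"
    and "completely_positive \<phi>" and "\<forall>a. norm (\<phi> a) \<le> norm a"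
    and "phi_map ip \<phi> \<Phi>"
    and "minimal_stinespring ip \<phi> \<Phi> \<pi> \<Psi> V W"
    and "compact_representation act ip \<Psi> W \<sigma>"
  defines "\<phi>t \<equiv> linking_map act ip \<sigma> \<Phi> \<phi>"
    and "L \<equiv> linking_algebra act ip"
    and "lstar \<equiv> adjoint_wrt (sum_ip ip) (sum_ip ip)"
    and "X\<phi> \<equiv> module_ternary_domain act \<phi> \<Phi>"
    and "M\<phi> \<equiv> mult_domain UNIV (*) \<phi>"
    and "T\<phi> \<equiv> ternary_domain UNIV (*) star \<phi>"
  shows "link_set act ip (compact_ops act ip X\<phi>) X\<phi> M\<phi> \<subseteq> mult_domain L (o\<^sub>L) \<phi>t \<and>
    mult_domain L (o\<^sub>L) \<phi>t = link_set act ip (compact_ops act ip UNIV) X\<phi> M\<phi> \<and>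
    ternary_domain L (o\<^sub>L) lstar \<phi>t = link_set act ip (compact_ops act ip UNIV) X\<phi> T\<phi>"
proof -
  interpret linked_stinespring act ip \<phi> \<Phi> \<pi> \<Psi> V W \<sigma>
    using assms(1,5,6) by (simp add: linked_stinespring_def linked_stinespring_axioms_def)
  have "link_set act ip (compact_ops act ip X\<phi>) X\<phi> M\<phi> \<subseteq> link_set act ip (compact_ops act ip UNIV) X\<phi> M\<phi>"
    by (intro link_set_mono compact_ops_mono subset_UNIV)
  then show ?thesis
    unfolding \<phi>t_def L_def lstar_def X\<phi>_def M\<phi>_def T\<phi>_def
    using mult_domain_linking ternary_domain_linking by blast
qed

end
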